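(* Let $\{X_t\}$ be an irreducible, positive recurrent birth-and-death process on $\{0,1,2,\ldots\}$, in discrete or continuous time, with birth parameters $\lambda_n>0$ ($n\ge 0$), death parameters $\mu_n>0$ ($n\ge 1$) and stationary distribution $(\pi_n)_{n\ge 0}$. Let $$K'=\sum_{j\ge 0}\pi_j\,\mathrm{E}_0[\theta_j],\qquad \Theta=\sum_{k\ge 0}(\lambda_k\pi_k)^{-1}\sum_{j\ge k+1}\pi_j .$$ Then $K'$ is finite if and only if $\Theta<\infty$. In that case, $K'=\Theta-\mathrm{E}_\pi[\theta_0]$, with $$\mathrm{E}_\pi[\theta_0]=\sum_{k\ge 0}(\lambda_k\pi_k)^{-1}\Big(\sum_{j\ge k+1}\pi_j\Big)^2<\Theta .$$
   Context: In continuous time, $\lambda_n$ and $\mu_n$ are the transition rates from $n$ to $n+1$ and from $n$ to $n-1$, respectively; in discrete time ($t\in\{0,1,2,\ldots\}$) they are the corresponding one-step transition probabilities, the remaining probability being that of staying in $n$ (there is no transition below $0$). Positive recurrence entails $B=\sum_{n\ge0}\beta_n<\infty$, where $\beta_0=1$ and $\beta_n=\frac{\lambda_0\lambda_1\cdots\lambda_{n-1}}{\mu_1\mu_2\cdots\mu_n}$ for $n\ge1$, and the stationary distribution is $\pi_n=B^{-1}\beta_n$. $\theta_j=\inf\{t\ge 0 : X_t=j\}$ is the first hitting time of $j$. $\mathrm{E}_i[\cdot]$ is conditional expectation given $X_0=i$, and $\mathrm{E}_\pi[\cdot]$ is conditional expectation given that $X_0$ has distribution $(\pi_n)$. *)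

theory Defs
  imports "HOL-Probability.Probability"
begin

text \<open>Discrete time is embedded in the reals, so that both time models share one process type.\<close>

datatype time_model = Discrete | Continuous

fun time_set :: "time_model \<Rightarrow> real set" where
  "time_set Discrete = \<nat>"
| "time_set Continuous = {0..}"

text \<open>The value \<open>mu 0\<close> is never used: there is no transition below 0.\<close>

definition bd_rate :: "(nat \<Rightarrow> real) \<Rightarrow> (nat \<Rightarrow> real) \<Rightarrow> nat \<Rightarrow> nat \<Rightarrow> real" where
  "bd_rate lam mu i j = (if j = Suc i then lam i else if i = Suc j then mu i else 0)"

definition bd_exit_rate :: "(nat \<Rightarrow> real) \<Rightarrow> (nat \<Rightarrow> real) \<Rightarrow> nat \<Rightarrow> real" where
  "bd_exit_rate lam mu i = lam i + (if i = 0 then 0 else mu i)"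

text \<open>Markov chain with initial law \<open>\<nu>\<close>. The last clause is the Markov property
  \<open>P(X\<^sub>n\<^sub>+\<^sub>1 = j | X\<^sub>0, \<dots>, X\<^sub>n) = p(X\<^sub>n, j)\<close>, multiplied out so that
  null histories need no separate treatment.\<close>

definition bd_discrete ::
  "(nat \<Rightarrow> real) \<Rightarrow> (nat \<Rightarrow> real) \<Rightarrow> nat pmf \<Rightarrow> 'w measure \<Rightarrow> (real \<Rightarrow> 'w \<Rightarrow> nat) \<Rightarrow> bool" where
  "bd_discrete lam mu \<nu> M X \<longleftrightarrow>
     prob_space M \<and>
     (\<forall>t\<in>\<nat>. X t \<in> measurable M (count_space UNIV)) \<and>
     (\<forall>i. measure M {\<omega> \<in> space M. X 0 \<omega> = i} = pmf \<nu> i) \<and>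
     (\<forall>(n::nat) (x :: nat \<Rightarrow> nat).
        measure M {\<omega> \<in> space M. \<forall>k\<le>Suc n. X (real k) \<omega> = x k} =
        measure M {\<omega> \<in> space M. \<forall>k\<le>n. X (real k) \<omega> = x k} *
        (if x (Suc n) = x n then 1 - bd_exit_rate lam mu (x n)
         else bd_rate lam mu (x n) (x (Suc n))))"

text \<open>Continuous-time Markov chain with initial law \<open>\<nu>\<close>, given by its jump chain \<open>Y\<close> and
  holding times \<open>S\<close>: given the past up to the \<open>n\<close>-th jump, the process stays in \<open>i = Y\<^sub>n\<close> for an
  exponential time whose parameter is the total rate \<open>q\<^sub>i\<close> out of \<open>i\<close>, and then,
  independently of that time, moves to \<open>j\<close> with probability \<open>q\<^sub>i\<^sub>j / q\<^sub>i\<close>.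
  The last clause says that \<open>X\<close> equals \<open>Y\<^sub>n\<close> between the \<open>n\<close>-th and the next jump, and that
  almost surely these intervals cover all of \<open>[0, \<infinity>)\<close>, i.e. the process does not explode (which
  is automatic for the minimal chain under recurrence). It holds for all \<open>t\<close> outside one
  null set, so paths are almost surely right-continuous step functions.\<close>

definition bd_continuous ::
  "(nat \<Rightarrow> real) \<Rightarrow> (nat \<Rightarrow> real) \<Rightarrow> nat pmf \<Rightarrow> 'w measure \<Rightarrow> (real \<Rightarrow> 'w \<Rightarrow> nat) \<Rightarrow> bool" where
  "bd_continuous lam mu \<nu> M X \<longleftrightarrow>
     prob_space M \<and>
     (\<forall>t\<ge>0. X t \<in> measurable M (count_space UNIV)) \<and>
     (\<exists>(Y :: nat \<Rightarrow> 'w \<Rightarrow> nat) (S :: nat \<Rightarrow> 'w \<Rightarrow> real).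
        (\<forall>n. Y n \<in> measurable M (count_space UNIV)) \<and>
        (\<forall>n. S n \<in> borel_measurable M) \<and>
        (\<forall>i. measure M {\<omega> \<in> space M. Y 0 \<omega> = i} = pmf \<nu> i) \<and>
        (\<forall>(n::nat) (y :: nat \<Rightarrow> nat) (s :: nat \<Rightarrow> real). (\<forall>k. 0 \<le> s k) \<longrightarrow>
           measure M {\<omega> \<in> space M. (\<forall>k\<le>Suc n. Y k \<omega> = y k) \<and> (\<forall>k<Suc n. s k < S k \<omega>)} =
           measure M {\<omega> \<in> space M. (\<forall>k\<le>n. Y k \<omega> = y k) \<and> (\<forall>k<n. s k < S k \<omega>)} *
           (exp (- bd_exit_rate lam mu (y n) * s n) *
            (bd_rate lam mu (y n) (y (Suc n)) / bd_exit_rate lam mu (y n)))) \<and>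
        (AE \<omega> in M. \<forall>t\<ge>0. \<exists>n. (\<Sum>k<n. S k \<omega>) \<le> t \<and> t < (\<Sum>k<Suc n. S k \<omega>) \<and>
                          X t \<omega> = Y n \<omega>))"

text \<open>\<open>P \<nu>\<close> is the probability measure under which \<open>X\<^sub>0\<close> has law \<open>\<nu>\<close>;
  \<open>P (return_pmf i)\<close> is the usual \<open>P\<^sub>i\<close>.\<close>

definition birth_death_process ::
  "time_model \<Rightarrow> (nat \<Rightarrow> real) \<Rightarrow> (nat \<Rightarrow> real) \<Rightarrow> (nat pmf \<Rightarrow> 'w measure) \<Rightarrow>
   (real \<Rightarrow> 'w \<Rightarrow> nat) \<Rightarrow> bool" where
  "birth_death_process T lam mu P X \<longleftrightarrow>
     (\<forall>\<nu>. case T of Discrete \<Rightarrow> bd_discrete lam mu \<nu> (P \<nu>) X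
                  | Continuous \<Rightarrow> bd_continuous lam mu \<nu> (P \<nu>) X)"

definition irreducible_process ::
  "time_model \<Rightarrow> (nat pmf \<Rightarrow> 'w measure) \<Rightarrow> (real \<Rightarrow> 'w \<Rightarrow> nat) \<Rightarrow> bool" where
  "irreducible_process T P X \<longleftrightarrow>
     (\<forall>i j. \<exists>t\<in>time_set T.
        measure (P (return_pmf i)) {\<omega> \<in> space (P (return_pmf i)). X t \<omega> = j} > 0)"

text \<open>Random times are \<open>ennreal\<close>-valued: the infimum of the empty set is \<open>\<infinity>\<close>.\<close>

definition hitting_time ::
  "time_model \<Rightarrow> (real \<Rightarrow> 'w \<Rightarrow> nat) \<Rightarrow> nat \<Rightarrow> 'w \<Rightarrow> ennreal" where
  "hitting_time T X j \<omega> = Inf (ennreal ` {t \<in> time_set T. X t \<omega> = j})"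

text \<open>In continuous time a return to \<open>i\<close> only counts after the process has left its initial state;
  in discrete time it may happen at time 1 without leaving.\<close>

fun return_time ::
  "time_model \<Rightarrow> (real \<Rightarrow> 'w \<Rightarrow> nat) \<Rightarrow> nat \<Rightarrow> 'w \<Rightarrow> ennreal" where
  "return_time Discrete X i \<omega> = Inf (ennreal ` {t \<in> \<nat>. 1 \<le> t \<and> X t \<omega> = i})"
| "return_time Continuous X i \<omega> =
     Inf (ennreal ` {t. X t \<omega> = i \<and> (\<exists>s. 0 \<le> s \<and> s < t \<and> X s \<omega> \<noteq> X 0 \<omega>)})"

definition positive_recurrent ::
  "time_model \<Rightarrow> (nat pmf \<Rightarrow> 'w measure) \<Rightarrow> (real \<Rightarrow> 'w \<Rightarrow> nat) \<Rightarrow> bool" where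
  "positive_recurrent T P X \<longleftrightarrow>
     (\<forall>i. (\<integral>\<^sup>+\<omega>. return_time T X i \<omega> \<partial>P (return_pmf i)) < \<infinity>)"

definition stationary_distribution ::
  "time_model \<Rightarrow> (nat pmf \<Rightarrow> 'w measure) \<Rightarrow> (real \<Rightarrow> 'w \<Rightarrow> nat) \<Rightarrow> nat pmf \<Rightarrow> bool" where
  "stationary_distribution T P X \<pi> \<longleftrightarrow>
     (\<forall>t\<in>time_set T. \<forall>j. measure (P \<pi>) {\<omega> \<in> space (P \<pi>). X t \<omega> = j} = pmf \<pi> j)"

definition mean_hitting_time ::
  "time_model \<Rightarrow> (nat pmf \<Rightarrow> 'w measure) \<Rightarrow> (real \<Rightarrow> 'w \<Rightarrow> nat) \<Rightarrow> nat pmf \<Rightarrow> nat \<Rightarrow> ennreal" where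
  "mean_hitting_time T P X \<nu> j = (\<integral>\<^sup>+\<omega>. hitting_time T X j \<omega> \<partial>P \<nu>)"

definition K_prime ::
  "time_model \<Rightarrow> (nat pmf \<Rightarrow> 'w measure) \<Rightarrow> (real \<Rightarrow> 'w \<Rightarrow> nat) \<Rightarrow> nat pmf \<Rightarrow> ennreal" where
  "K_prime T P X \<pi> = (\<Sum>j. ennreal (pmf \<pi> j) * mean_hitting_time T P X (return_pmf 0) j)"

definition Theta :: "(nat \<Rightarrow> real) \<Rightarrow> nat pmf \<Rightarrow> ennreal" where
  "Theta lam \<pi> =
     (\<Sum>k. ennreal (inverse (lam k * pmf \<pi> k) * (\<Sum>\<^sub>\<infinity>j\<in>{k+1..}. pmf \<pi> j)))"

end

theory Submission imports Defs begin

text \<open>In both time models the hitting time of \<open>j\<close> is the sum of the holding times of a nearest-neighbour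
  chain stopped at \<open>j\<close>, so its mean is the sum over \<open>i\<close> of the expected times \<open>x\<^sub>i\<close> spent in \<open>i\<close> before
  hitting \<open>j\<close>. The \<open>x\<^sub>i\<close> solve the balance equations, and summing these gives a first-order
  recurrence for the flux across each edge. Started at 0 the flux up to \<open>j\<close> is 1; started from \<open>\<pi>\<close>
  with target 0 the downward flux from \<open>k + 1\<close> to \<open>k\<close> is the tail \<open>t\<^sub>k\<close> of \<open>\<pi>\<close>. Solving with weights
  \<open>c\<^sub>k = 1 / (\<lambda>\<^sub>k \<pi>\<^sub>k)\<close>, the three quantities become the sums of \<open>c\<^sub>k (1 - t\<^sub>k) t\<^sub>k\<close>, \<open>c\<^sub>k t\<^sub>k\<^sup>2\<close> and
  \<open>c\<^sub>k t\<^sub>k\<close>, and the theorem follows from \<open>\<pi>\<^sub>0 \<le> 1 - t\<^sub>k \<le> 1\<close>. Recurrence enters through the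
  divergence of \<open>\<Sum> 1 / (\<lambda>\<^sub>k \<beta>\<^sub>k)\<close>, which also turns \<open>\<pi> Q \<le> 0\<close> into detailed balance.\<close>

section \<open>Sums and histories\<close>

lemma suminf_swap_ennreal:
  fixes f :: "nat \<Rightarrow> nat \<Rightarrow> ennreal"
  shows "(\<Sum>i. \<Sum>j. f i j) = (\<Sum>j. \<Sum>i. f i j)"
  using nn_integral_count_space_nn_integral[of UNIV "\<lambda>j i. f i j" "count_space UNIV"]
  by (simp add: nn_integral_count_space_nat)

text \<open>Tonelli on the triangle \<open>k < i\<close>. When \<open>a\<close> is a probability
  mass function the inner sums on the right are its tails, so a sum over states becomes a series
  over edges.\<close>

lemma suminf_triangle_ennreal:
  fixes a t :: "nat \<Rightarrow> ennreal"
  shows "(\<Sum>i. a i * (\<Sum>k<i. t k)) = (\<Sum>k. t k * (\<Sum>i. a (i + Suc k)))"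
proof -
  have *: "(\<Sum>k<i. t k) = (\<Sum>k. t k * (if k < i then 1 else 0))" for i
  proof -
    have "(\<Sum>k. t k * (if k < i then 1 else 0)) = (\<Sum>k<i. t k * (if k < i then 1 else 0))"
      by (rule suminf_finite) auto
    also have "\<dots> = (\<Sum>k<i. t k)" by (rule sum.cong) auto
    finally show ?thesis by simp
  qed
  have "(\<Sum>i. a i * (\<Sum>k<i. t k)) = (\<Sum>i. \<Sum>k. a i * (t k * (if k < i then 1 else 0)))"
    by (simp add: *)
  also have "\<dots> = (\<Sum>k. \<Sum>i. a i * (t k * (if k < i then 1 else 0)))"
    by (rule suminf_swap_ennreal)
  also have "\<dots> = (\<Sum>k. t k * (\<Sum>i. a i * (if k < i then 1 else 0)))"
    by (subst ennreal_suminf_cmult[symmetric]) (simp add: mult_ac)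
  also have "\<dots> = (\<Sum>k. t k * (\<Sum>i. a (i + Suc k)))"
  proof -
    have "(\<Sum>i. a i * (if k < i then 1 else 0)) = (\<Sum>i. a (i + Suc k))" for k
      by (subst suminf_offset[where i = "Suc k"]) auto
    then show ?thesis by simp
  qed
  finally show ?thesis .
qed

text \<open>The tail occurs as an infinite sum of reals in \<open>Theta\<close> and as an
  \<open>ennreal\<close> series after an exchange of sums; both reduce to one minus a finite
  head.\<close>

lemma pmf_tail:
  fixes p :: "nat pmf"
  shows "(\<Sum>\<^sub>\<infinity>j\<in>{k+1..}. pmf p j) = 1 - (\<Sum>j\<le>k. pmf p j)"
    and "(\<Sum>j. ennreal (pmf p (j + Suc k))) = ennreal (1 - (\<Sum>j\<le>k. pmf p j))"
    and "(\<Sum>j\<le>k. pmf p j) \<le> 1"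
proof -
  have m: "measure_pmf.prob p {..k} = (\<Sum>j\<le>k. pmf p j)"
    by (simp add: measure_measure_pmf_finite)
  have c: "measure_pmf.prob p {k+1..} = 1 - (\<Sum>j\<le>k. pmf p j)"
  proof -
    have "{k+1..} = UNIV - {..k}" by auto
    then show ?thesis using measure_pmf.prob_compl[of "{..k}" p] m by simp
  qed
  have "infsetsum (pmf p) {k+1..} = measure_pmf.prob p {k+1..}"
    by (rule measure_pmf_conv_infsetsum[symmetric])
  then show "(\<Sum>\<^sub>\<infinity>j\<in>{k+1..}. pmf p j) = 1 - (\<Sum>j\<le>k. pmf p j)"
    using infsetsum_infsum[OF pmf_abs_summable] c by metis
  show "(\<Sum>j\<le>k. pmf p j) \<le> 1" unfolding m[symmetric] by simp
  have "ennreal (1 - (\<Sum>j\<le>k. pmf p j)) = emeasure (measure_pmf p) {k+1..}"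
    using c by (simp add: measure_pmf.emeasure_eq_measure)
  also have "\<dots> = emeasure (measure_pmf p) (\<Union>j. {j + Suc k})"
    by (rule arg_cong[where f = "emeasure (measure_pmf p)"])
       (auto dest: le_Suc_ex simp: add.commute)
  also have "\<dots> = (\<Sum>j. emeasure (measure_pmf p) {j + Suc k})"
    by (rule suminf_emeasure[symmetric]) (auto simp: disjoint_family_on_def)
  also have "\<dots> = (\<Sum>j. ennreal (pmf p (j + Suc k)))"
    by (simp add: emeasure_pmf_single)
  finally show "(\<Sum>j. ennreal (pmf p (j + Suc k))) = ennreal (1 - (\<Sum>j\<le>k. pmf p j))" ..
qed

text \<open>Lists of naturals form a countable type, so a coordinate can be prepended by treating
  each of its countably many values separately.\<close>

lemma measurable_history [measurable]:
  fixes Y :: "nat \<Rightarrow> 'w \<Rightarrow> nat"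
  assumes "\<And>k. Y k \<in> measurable M (count_space UNIV)"
  shows "(\<lambda>\<omega>. map (\<lambda>k. Y k \<omega>) ks) \<in> measurable M (count_space UNIV)"
proof (induction ks)
  case (Cons k ks)
  have "(\<lambda>\<omega>. y # map (\<lambda>k. Y k \<omega>) ks) \<in> measurable M (count_space UNIV)" for y
    by (rule measurable_compose[OF Cons]) simp
  then have "(\<lambda>\<omega>. Y k \<omega> # map (\<lambda>k. Y k \<omega>) ks) \<in> measurable M (count_space UNIV)"
    by (rule measurable_compose_countable[OF _ assms])
  then show ?case by simp
qed simp

text \<open>A list of length \<open>Suc n\<close> fixes one cylinder of paths, and each path lies in
  exactly one. Events about a history thus reduce to the cylinders in terms of which the Markov
  property is stated.\<close>

lemma nn_integral_history:
  fixes Y :: "nat \<Rightarrow> 'w \<Rightarrow> nat"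
  assumes [measurable]: "\<And>k. Y k \<in> measurable M (count_space UNIV)" "Z \<in> borel_measurable M"
  shows "(\<integral>\<^sup>+\<omega>. Z \<omega> * indicator {\<omega> \<in> space M. Q (map (\<lambda>k. Y k \<omega>) [0..<Suc n])} \<omega> \<partial>M) =
    (\<integral>\<^sup>+l. (if length l = Suc n \<and> Q l
        then \<integral>\<^sup>+\<omega>. Z \<omega> * indicator {\<omega> \<in> space M. \<forall>k\<le>n. Y k \<omega> = l ! k} \<omega> \<partial>M else 0)
      \<partial>count_space UNIV)"
proof -
  let ?L = "\<lambda>\<omega>. map (\<lambda>k. Y k \<omega>) [0..<Suc n]"
  let ?g = "\<lambda>l \<omega>. (if length l = Suc n \<and> Q l then Z \<omega> * indicator {\<omega> \<in> space M. \<forall>k\<le>n. Y k \<omega> = l ! k} \<omega> else 0)"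
  have eq: "(\<forall>k\<le>n. Y k \<omega> = l ! k) \<longleftrightarrow> l = ?L \<omega>" if "length l = Suc n" for l \<omega>
    using that by (auto simp: list_eq_iff_nth_eq simp del: upt_Suc)
  have "(\<integral>\<^sup>+l. ?g l \<omega> \<partial>count_space UNIV) = Z \<omega> * indicator {\<omega> \<in> space M. Q (?L \<omega>)} \<omega>"
    if "\<omega> \<in> space M" for \<omega>
  proof -
    have "(\<integral>\<^sup>+l. ?g l \<omega> \<partial>count_space UNIV) = (\<integral>\<^sup>+l. ?g l \<omega> * indicator {?L \<omega>} l \<partial>count_space UNIV)"
    proof (rule nn_integral_cong)
      fix l
      show "?g l \<omega> = ?g l \<omega> * indicator {?L \<omega>} l"
        using eq[of l \<omega>] by (cases "l = ?L \<omega>") (auto simp del: upt_Suc)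
    qed
    also have "\<dots> = ?g (?L \<omega>) \<omega>"
      using nn_integral_indicator_singleton[of "?L \<omega>" "count_space UNIV" "\<lambda>l. ?g l \<omega>"]
      by (simp del: upt_Suc)
    also have "\<dots> = Z \<omega> * indicator {\<omega> \<in> space M. Q (?L \<omega>)} \<omega>"
      using eq[of "?L \<omega>" \<omega>] that by (auto simp del: upt_Suc simp: indicator_def)
    finally show ?thesis .
  qed
  then have "(\<integral>\<^sup>+\<omega>. Z \<omega> * indicator {\<omega> \<in> space M. Q (?L \<omega>)} \<omega> \<partial>M) =
      (\<integral>\<^sup>+\<omega>. \<integral>\<^sup>+l. ?g l \<omega> \<partial>count_space UNIV \<partial>M)"
    by (intro nn_integral_cong) simp
  also have "\<dots> = (\<integral>\<^sup>+l. \<integral>\<^sup>+\<omega>. ?g l \<omega> \<partial>M \<partial>count_space UNIV)"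
  proof (rule nn_integral_count_space_nn_integral)
    show "?g l \<in> borel_measurable M" for l
      by (cases "length l = Suc n \<and> Q l") (simp_all)
  qed simp
  also have "\<dots> = (\<integral>\<^sup>+l. (if length l = Suc n \<and> Q l
        then \<integral>\<^sup>+\<omega>. Z \<omega> * indicator {\<omega> \<in> space M. \<forall>k\<le>n. Y k \<omega> = l ! k} \<omega> \<partial>M else 0)
      \<partial>count_space UNIV)"
    by (intro nn_integral_cong) auto
  finally show ?thesis .
qed

text \<open>Lifts an identity from cylinders to history events. The factor may depend on the current
  state, and \<open>Q\<close> has to determine it. The same scheme serves transitions, mean holding
  times and positivity of the holding times.\<close>

lemma nn_integral_history_mult:
  fixes Y :: "nat \<Rightarrow> 'w \<Rightarrow> nat"
  assumes [measurable]: "\<And>k. Y k \<in> measurable M (count_space UNIV)" "Z \<in> borel_measurable M"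
    "W \<in> borel_measurable M"
    and Z: "\<And>x. (\<integral>\<^sup>+\<omega>. Z \<omega> * indicator {\<omega> \<in> space M. \<forall>k\<le>n. Y k \<omega> = x k} \<omega> \<partial>M) =
       c (x n) * (\<integral>\<^sup>+\<omega>. W \<omega> * indicator {\<omega> \<in> space M. \<forall>k\<le>n. Y k \<omega> = x k} \<omega> \<partial>M)"
    and Q: "\<And>l. length l = Suc n \<Longrightarrow> Q l \<Longrightarrow> c (l ! n) = d"
  shows "(\<integral>\<^sup>+\<omega>. Z \<omega> * indicator {\<omega> \<in> space M. Q (map (\<lambda>k. Y k \<omega>) [0..<Suc n])} \<omega> \<partial>M) =
    d * (\<integral>\<^sup>+\<omega>. W \<omega> * indicator {\<omega> \<in> space M. Q (map (\<lambda>k. Y k \<omega>) [0..<Suc n])} \<omega> \<partial>M)"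
proof -
  have "(\<integral>\<^sup>+\<omega>. Z \<omega> * indicator {\<omega> \<in> space M. Q (map (\<lambda>k. Y k \<omega>) [0..<Suc n])} \<omega> \<partial>M) =
    (\<integral>\<^sup>+l. d * (if length l = Suc n \<and> Q l
        then \<integral>\<^sup>+\<omega>. W \<omega> * indicator {\<omega> \<in> space M. \<forall>k\<le>n. Y k \<omega> = l ! k} \<omega> \<partial>M else 0)
      \<partial>count_space UNIV)"
    unfolding nn_integral_history[of Y M Z Q n, OF assms(1,2)]
    by (intro nn_integral_cong) (auto simp: Z Q)
  also have "\<dots> = d * (\<integral>\<^sup>+\<omega>. W \<omega> * indicator {\<omega> \<in> space M. Q (map (\<lambda>k. Y k \<omega>) [0..<Suc n])} \<omega> \<partial>M)"
    unfolding nn_integral_history[of Y M W Q n, OF assms(1,3)]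
    by (subst nn_integral_cmult) auto
  finally show ?thesis .
qed

section \<open>Nearest-neighbour chains and occupation times\<close>

text \<open>The weight \<open>w i\<close> is the mean holding time in \<open>i\<close>: 1 in discrete time, where the chain \<open>step\<close>
  may stay put, and the inverse exit rate in continuous time, where \<open>step\<close> is the jump chain.\<close>

locale bd_rates =
  fixes lam mu w :: "nat \<Rightarrow> real"
  assumes lam_pos: "lam n > 0"
    and mu_pos: "n \<ge> 1 \<Longrightarrow> mu n > 0"
    and w_pos: "w n > 0"
    and w_exit_le: "w n * bd_exit_rate lam mu n \<le> 1"
begin

text \<open>The matrix \<open>I + diag(w) Q\<close> with \<open>Q\<close> the generator. For
  \<open>w i\<close> the inverse exit rate its diagonal vanishes, which gives the jump
  chain.\<close>

definition step :: "nat \<Rightarrow> nat \<Rightarrow> real" where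
  "step i j = (if j = i then 1 - w i * bd_exit_rate lam mu i else w i * bd_rate lam mu i j)"

lemma step_nonneg: "0 \<le> step i j"
  using lam_pos[of i] mu_pos[of i] w_pos[of i] w_exit_le[of i]
  by (cases i) (auto simp: step_def bd_rate_def)

lemma step_sums:
  assumes "(\<lambda>i. step i l * g i) sums s"
  shows "s = (if l = 0 then 0 else w (l - 1) * lam (l - 1) * g (l - 1)) +
    (1 - w l * bd_exit_rate lam mu l) * g l + w (Suc l) * mu (Suc l) * g (Suc l)"
proof -
  \<comment> \<open>At \<open>l = 0\<close> truncated subtraction merges \<open>l - 1\<close> with
    \<open>l\<close>, which matches the missing birth term.\<close>
  have "(\<lambda>i. step i l * g i) sums (\<Sum>i\<in>{l - 1, l, Suc l}. step i l * g i)"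
    by (rule sums_finite) (auto simp: step_def bd_rate_def)
  with assms have "s = (\<Sum>i\<in>{l - 1, l, Suc l}. step i l * g i)"
    by (rule sums_unique2)
  then show ?thesis
    by (cases l) (auto simp: step_def bd_rate_def)
qed

end

text \<open>What both time models supply. The mean of a sum of holding times depends on them only
  through their conditional means given the past states, hence the form of
  \<open>holding\<close>.\<close>

locale bd_chain = bd_rates lam mu w + prob_space M
  for lam mu w :: "nat \<Rightarrow> real" and M :: "'w measure" +
  fixes Y :: "nat \<Rightarrow> 'w \<Rightarrow> nat" and S :: "nat \<Rightarrow> 'w \<Rightarrow> real" and \<nu> :: "nat pmf"
  assumes Y_measurable[measurable]: "Y n \<in> measurable M (count_space UNIV)"
    and S_measurable[measurable]: "S n \<in> borel_measurable M"
    and initial: "prob {\<omega> \<in> space M. Y 0 \<omega> = i} = pmf \<nu> i"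
    and transition: "prob {\<omega> \<in> space M. \<forall>k\<le>Suc n. Y k \<omega> = x k} =
      prob {\<omega> \<in> space M. \<forall>k\<le>n. Y k \<omega> = x k} * step (x n) (x (Suc n))"
    and holding: "(\<integral>\<^sup>+\<omega>. ennreal (S n \<omega>) * indicator {\<omega> \<in> space M. \<forall>k\<le>n. Y k \<omega> = x k} \<omega> \<partial>M) =
      ennreal (w (x n)) * emeasure M {\<omega> \<in> space M. \<forall>k\<le>n. Y k \<omega> = x k}"
begin

text \<open>On every cylinder ending in \<open>i\<close> the conditional probability of a move to
  \<open>j\<close> is the same, so the Markov property extends to all events about the past that fix
  the present state.\<close>

lemma transition_history:
  assumes "\<And>l. length l = Suc n \<Longrightarrow> Q l \<Longrightarrow> l ! n = i"
  shows "prob {\<omega> \<in> space M. Q (map (\<lambda>k. Y k \<omega>) [0..<Suc n]) \<and> Y (Suc n) \<omega> = j} =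
    step i j * prob {\<omega> \<in> space M. Q (map (\<lambda>k. Y k \<omega>) [0..<Suc n])}"
proof -
  let ?A = "{\<omega> \<in> space M. Q (map (\<lambda>k. Y k \<omega>) [0..<Suc n])}"
  let ?B = "{\<omega> \<in> space M. Y (Suc n) \<omega> = j}"
  have "Measurable.pred M (\<lambda>\<omega>. Q (map (\<lambda>k. Y k \<omega>) [0..<Suc n]))"
    by (rule measurable_compose[OF measurable_history]) (simp_all add: Y_measurable)
  then have [measurable]: "?A \<in> sets M"
    by measurable
  have "(\<integral>\<^sup>+\<omega>. indicator ?B \<omega> * indicator ?A \<omega> \<partial>M) =
      ennreal (step i j) * (\<integral>\<^sup>+\<omega>. 1 * indicator ?A \<omega> \<partial>M)"
  proof (rule nn_integral_history_mult[where c = "\<lambda>i. ennreal (step i j)"])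
    fix x :: "nat \<Rightarrow> nat"
    let ?H = "{\<omega> \<in> space M. \<forall>k\<le>n. Y k \<omega> = x k}"
    have "(\<integral>\<^sup>+\<omega>. indicator ?B \<omega> * indicator ?H \<omega> \<partial>M) = emeasure M (?B \<inter> ?H)"
      by (simp add: indicator_inter_arith[symmetric])
    also have "?B \<inter> ?H = {\<omega> \<in> space M. \<forall>k\<le>Suc n. Y k \<omega> = (x(Suc n := j)) k}"
      by (auto simp: le_Suc_eq)
    also have "emeasure M \<dots> = ennreal (prob ?H * step (x n) j)"
      unfolding emeasure_eq_measure transition
      by (intro arg_cong[where f = ennreal] arg_cong2[where f = "(*)"] arg_cong[where f = prob]) auto
    also have "\<dots> = ennreal (step (x n) j) * (\<integral>\<^sup>+\<omega>. 1 * indicator ?H \<omega> \<partial>M)"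
      by (simp add: emeasure_eq_measure ennreal_mult step_nonneg mult.commute)
    finally show "(\<integral>\<^sup>+\<omega>. indicator ?B \<omega> * indicator ?H \<omega> \<partial>M) =
      ennreal (step (x n) j) * (\<integral>\<^sup>+\<omega>. 1 * indicator ?H \<omega> \<partial>M)" .
  qed (use assms in auto)
  then have "emeasure M (?B \<inter> ?A) = ennreal (step i j) * emeasure M ?A"
    by (simp add: indicator_inter_arith[symmetric] del: upt_Suc)
  then have "prob (?B \<inter> ?A) = step i j * prob ?A"
    by (simp add: emeasure_eq_measure step_nonneg flip: ennreal_mult del: upt_Suc)
  also have "?B \<inter> ?A = {\<omega> \<in> space M. Q (map (\<lambda>k. Y k \<omega>) [0..<Suc n]) \<and> Y (Suc n) \<omega> = j}"
    by auto
  finally show ?thesis .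
qed

section \<open>Taboo probabilities\<close>

text \<open>The lower end \<open>m\<close> is 0 for hitting times and 1 for return times, where the
  initial state may be \<open>j\<close> itself.\<close>

definition taboo :: "nat \<Rightarrow> nat \<Rightarrow> nat \<Rightarrow> nat \<Rightarrow> real" where
  "taboo j m n i = prob {\<omega> \<in> space M. (\<forall>k\<in>{m..n}. Y k \<omega> \<noteq> j) \<and> Y n \<omega> = i}"

definition survival :: "nat \<Rightarrow> nat \<Rightarrow> nat \<Rightarrow> real" where
  "survival j m n = prob {\<omega> \<in> space M. \<forall>k\<in>{m..n}. Y k \<omega> \<noteq> j}"

lemma taboo_nonneg: "0 \<le> taboo j m n i"
  by (simp add: taboo_def)

lemma taboo_same: "m \<le> n \<Longrightarrow> taboo j m n j = 0"
proof -
  assume "m \<le> n"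
  then have "{\<omega> \<in> space M. (\<forall>k\<in>{m..n}. Y k \<omega> \<noteq> j) \<and> Y n \<omega> = j} = {}" by auto
  then show ?thesis by (simp only: taboo_def measure_empty)
qed

lemma taboo_0: "j \<noteq> i \<Longrightarrow> taboo j 0 0 i = pmf \<nu> i"
  by (auto simp: taboo_def simp flip: initial intro!: arg_cong[where f = prob])

lemma sums_prob_partition:
  fixes m n j :: nat
  assumes [measurable]: "Measurable.pred M B"
  shows "(\<lambda>i. prob {\<omega> \<in> space M. B \<omega> \<and> Y n \<omega> = i}) sums prob {\<omega> \<in> space M. B \<omega>}"
proof -
  have "(\<lambda>i. prob {\<omega> \<in> space M. B \<omega> \<and> Y n \<omega> = i}) sums
      prob (\<Union>i. {\<omega> \<in> space M. B \<omega> \<and> Y n \<omega> = i})"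
    by (rule finite_measure_UNION) (auto simp: disjoint_family_on_def)
  also have "(\<Union>i. {\<omega> \<in> space M. B \<omega> \<and> Y n \<omega> = i}) = {\<omega> \<in> space M. B \<omega>}"
    by auto
  finally show ?thesis .
qed

lemma taboo_sums_survival: "(\<lambda>i. taboo j m n i) sums survival j m n"
  unfolding taboo_def survival_def by (rule sums_prob_partition) measurable

text \<open>For \<open>l \<noteq> j\<close> the right side is the next taboo probability; for
  \<open>l = j\<close> it is the probability that \<open>j\<close> is entered at
  \<open>Suc n\<close> after being avoided from \<open>m\<close> to \<open>n\<close>. The forward
  equation and the loss of survival probability both come from it.\<close>

lemma taboo_sums_next:
  "(\<lambda>i. step i l * taboo j m n i) sums
    prob {\<omega> \<in> space M. (\<forall>k\<in>{m..n}. Y k \<omega> \<noteq> j) \<and> Y (Suc n) \<omega> = l}"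
proof -
  have "step i l * taboo j m n i =
      prob {\<omega> \<in> space M. ((\<forall>k\<in>{m..n}. Y k \<omega> \<noteq> j) \<and> Y (Suc n) \<omega> = l) \<and> Y n \<omega> = i}" for i
  proof -
    let ?Q = "\<lambda>l :: nat list. (\<forall>k\<in>{m..n}. l ! k \<noteq> j) \<and> l ! n = i"
    have *: "?Q (map (\<lambda>k. Y k \<omega>) [0..<Suc n]) \<longleftrightarrow> (\<forall>k\<in>{m..n}. Y k \<omega> \<noteq> j) \<and> Y n \<omega> = i" for \<omega>
      by (auto simp del: upt_Suc)
    show ?thesis
      using transition_history[of n ?Q i l] unfolding * taboo_def
      by (auto simp: conj_ac intro!: arg_cong[where f = prob])
  qed
  then show ?thesis
    by (simp only:) (rule sums_prob_partition, measurable)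
qed

lemma taboo_Suc_sums:
  assumes "l \<noteq> j"
  shows "(\<lambda>i. step i l * taboo j m n i) sums taboo j m (Suc n) l"
proof -
  have "{\<omega> \<in> space M. (\<forall>k\<in>{m..n}. Y k \<omega> \<noteq> j) \<and> Y (Suc n) \<omega> = l} =
      {\<omega> \<in> space M. (\<forall>k\<in>{m..Suc n}. Y k \<omega> \<noteq> j) \<and> Y (Suc n) \<omega> = l}"
    using assms by (auto simp: le_Suc_eq)
  then show ?thesis
    using taboo_sums_next[of l j m n] by (simp add: taboo_def)
qed

text \<open>Forward equation of the chain killed at \<open>j\<close>: a step into
  \<open>l \<noteq> j\<close> keeps the path alive.\<close>

lemma taboo_Suc:
  assumes "l \<noteq> j"
  shows "taboo j m (Suc n) l =
    (if l = 0 then 0 else w (l - 1) * lam (l - 1) * taboo j m n (l - 1)) +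
    (1 - w l * bd_exit_rate lam mu l) * taboo j m n l + w (Suc l) * mu (Suc l) * taboo j m n (Suc l)"
  by (rule step_sums[OF taboo_Suc_sums[OF assms]])

text \<open>The drop is the probability of entering \<open>j\<close> at time \<open>Suc n\<close>.
  The middle term can be nonzero only for \<open>m = Suc n\<close>, when no time up to
  \<open>n\<close> is forbidden.\<close>

lemma survival_diff:
  assumes "m \<le> Suc n"
  shows "survival j m n - survival j m (Suc n) =
    (if j = 0 then 0 else w (j - 1) * lam (j - 1) * taboo j m n (j - 1)) +
    (1 - w j * bd_exit_rate lam mu j) * taboo j m n j + w (Suc j) * mu (Suc j) * taboo j m n (Suc j)"
proof -
  let ?A = "{\<omega> \<in> space M. \<forall>k\<in>{m..n}. Y k \<omega> \<noteq> j}"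
  let ?B = "{\<omega> \<in> space M. \<forall>k\<in>{m..Suc n}. Y k \<omega> \<noteq> j}"
  have "survival j m n - survival j m (Suc n) = prob (?A - ?B)"
    unfolding survival_def by (rule finite_measure_Diff[symmetric]) auto
  also have "?A - ?B = {\<omega> \<in> space M. (\<forall>k\<in>{m..n}. Y k \<omega> \<noteq> j) \<and> Y (Suc n) \<omega> = j}"
    using assms by (auto simp: le_Suc_eq)
  finally show ?thesis
    using step_sums[OF taboo_sums_next[of j j m n]] by simp
qed

lemma survival_tendsto:
  "survival j m \<longlonglongrightarrow> prob {\<omega> \<in> space M. \<forall>k\<ge>m. Y k \<omega> \<noteq> j}"
proof -
  have "(\<lambda>n. prob {\<omega> \<in> space M. \<forall>k\<in>{m..n}. Y k \<omega> \<noteq> j}) \<longlonglongrightarrow>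
      prob (\<Inter>n. {\<omega> \<in> space M. \<forall>k\<in>{m..n}. Y k \<omega> \<noteq> j})"
    by (rule finite_Lim_measure_decseq) (auto simp: decseq_def)
  also have "(\<Inter>n. {\<omega> \<in> space M. \<forall>k\<in>{m..n}. Y k \<omega> \<noteq> j}) = {\<omega> \<in> space M. \<forall>k\<ge>m. Y k \<omega> \<noteq> j}"
    by (auto dest: spec[of _ "_ :: nat"]) (metis atLeastAtMost_iff order_refl)
  finally show ?thesis by (simp add: survival_def[abs_def])
qed

section \<open>Occupation times\<close>

text \<open>The expected time in \<open>i\<close> before \<open>j\<close> is hit, a Green function
  of the killed chain. Being a real \<open>suminf\<close>, it has this meaning only when the series
  is summable, so summability is proved separately.\<close>

definition occupation :: "nat \<Rightarrow> nat \<Rightarrow> real" where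
  "occupation j i = w i * (\<Sum>n. taboo j 0 n i)"

lemma occupation_nonneg:
  assumes "summable (\<lambda>n. taboo j 0 n i)"
  shows "0 \<le> occupation j i"
  using w_pos[of i] by (simp add: occupation_def suminf_nonneg[OF assms taboo_nonneg])

text \<open>A visit to the neighbour \<open>k\<close> is followed by one to \<open>i\<close> with
  the fixed probability \<open>step k i > 0\<close>, and since \<open>i \<noteq> j\<close> that
  visit is still counted. Finiteness thus spreads from \<open>i\<close> to its neighbours.\<close>

lemma summable_taboo_neighbour:
  assumes "i \<noteq> j" "summable (\<lambda>n. taboo j m n i)" "k = Suc i \<or> i = Suc k"
  shows "summable (\<lambda>n. taboo j m n k)"
proof -
  have c: "step k i > 0"
    using assms(3) lam_pos[of k] mu_pos[of k] w_pos[of k] by (auto simp: step_def bd_rate_def)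
  have le: "step k i * taboo j m n k \<le> taboo j m (Suc n) i" for n
  proof -
    have sums: "(\<lambda>k. step k i * taboo j m n k) sums taboo j m (Suc n) i"
      by (rule taboo_Suc_sums[OF assms(1)])
    have "(\<Sum>k\<in>{k}. step k i * taboo j m n k) \<le> (\<Sum>k. step k i * taboo j m n k)"
      by (rule sum_le_suminf[OF sums_summable[OF sums]]) (simp_all add: step_nonneg taboo_nonneg)
    then show ?thesis using sums_unique[OF sums] by simp
  qed
  have "summable (\<lambda>n. step k i * taboo j m n k)"
  proof (rule summable_comparison_test')
    show "summable (\<lambda>n. taboo j m (Suc n) i)"
      using assms(2) by (subst summable_Suc_iff)
    show "norm (step k i * taboo j m n k) \<le> taboo j m (Suc n) i" for n
      using le[of n] step_nonneg[of k i] taboo_nonneg[of j m n k] by simp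
  qed
  then show ?thesis
    using c by (simp add: summable_cmult_iff)
qed

text \<open>The forward equation summed over all times. The shift by one step leaves the initial
  mass, and \<open>w\<close> is absorbed into \<open>occupation\<close>.\<close>

lemma occupation_balance:
  assumes "i \<noteq> j"
    and "summable (\<lambda>n. taboo j 0 n (i - 1))" "summable (\<lambda>n. taboo j 0 n i)"
      "summable (\<lambda>n. taboo j 0 n (Suc i))"
  shows "bd_exit_rate lam mu i * occupation j i =
    pmf \<nu> i + (if i = 0 then 0 else lam (i - 1) * occupation j (i - 1)) + mu (Suc i) * occupation j (Suc i)"
proof -
  let ?G = "\<lambda>i. (\<Sum>n. taboo j 0 n i)"
  have "(\<Sum>n. taboo j 0 (Suc n) i) = ?G i - pmf \<nu> i"
    using suminf_split_head[OF assms(3)] taboo_0[of j i] assms(1) by simp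
  moreover have "(\<lambda>n. taboo j 0 (Suc n) i) sums
    ((if i = 0 then 0 else w (i - 1) * lam (i - 1) * ?G (i - 1)) +
    (1 - w i * bd_exit_rate lam mu i) * ?G i + w (Suc i) * mu (Suc i) * ?G (Suc i))"
    unfolding taboo_Suc[OF assms(1)]
    by (cases i) (use assms(2-4) in \<open>auto intro!: sums_add sums_mult summable_sums\<close>)
  ultimately have "?G i - pmf \<nu> i = (if i = 0 then 0 else w (i - 1) * lam (i - 1) * ?G (i - 1)) +
    (1 - w i * bd_exit_rate lam mu i) * ?G i + w (Suc i) * mu (Suc i) * ?G (Suc i)"
    by (simp add: sums_iff)
  then show ?thesis
    by (simp add: occupation_def algebra_simps split: if_splits)
qed

text \<open>The time before hitting \<open>j\<close> is regrouped by the state in which it is spent;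
  on the event of being in \<open>i\<close> at step \<open>n\<close> the holding time may be
  replaced by its mean \<open>w i\<close>.\<close>

lemma nn_integral_holding:
  assumes "\<And>i. summable (\<lambda>n. taboo j 0 n i)"
  shows "(\<Sum>n. \<integral>\<^sup>+\<omega>. ennreal (S n \<omega>) * indicator {\<omega> \<in> space M. \<forall>k\<le>n. Y k \<omega> \<noteq> j} \<omega> \<partial>M) =
    (\<Sum>i. ennreal (occupation j i))"
proof -
  have *: "(\<integral>\<^sup>+\<omega>. ennreal (S n \<omega>) * indicator {\<omega> \<in> space M. \<forall>k\<le>n. Y k \<omega> \<noteq> j} \<omega> \<partial>M) =
    (\<Sum>i. ennreal (w i * taboo j 0 n i))" for n
  proof -
    let ?Q = "\<lambda>i (l :: nat list). (\<forall>k\<in>{0..n}. l ! k \<noteq> j) \<and> l ! n = i"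
    have Q: "?Q i (map (\<lambda>k. Y k \<omega>) [0..<Suc n]) \<longleftrightarrow> (\<forall>k\<in>{0..n}. Y k \<omega> \<noteq> j) \<and> Y n \<omega> = i" for i \<omega>
      by (auto simp del: upt_Suc)
    have I: "(\<integral>\<^sup>+\<omega>. ennreal (S n \<omega>) * indicator {\<omega> \<in> space M. (\<forall>k\<in>{0..n}. Y k \<omega> \<noteq> j) \<and> Y n \<omega> = i} \<omega> \<partial>M) =
      ennreal (w i * taboo j 0 n i)" for i
    proof -
      have "(\<integral>\<^sup>+\<omega>. ennreal (S n \<omega>) * indicator {\<omega> \<in> space M. ?Q i (map (\<lambda>k. Y k \<omega>) [0..<Suc n])} \<omega> \<partial>M) =
        ennreal (w i) * (\<integral>\<^sup>+\<omega>. 1 * indicator {\<omega> \<in> space M. ?Q i (map (\<lambda>k. Y k \<omega>) [0..<Suc n])} \<omega> \<partial>M)"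
        by (rule nn_integral_history_mult[where c = "\<lambda>i. ennreal (w i)"]) (auto simp: holding)
      then show ?thesis
        unfolding Q using w_pos[of i]
        by (simp add: taboo_def emeasure_eq_measure flip: ennreal_mult)
    qed
    have ind: "ennreal (S n \<omega>) * indicator {\<omega> \<in> space M. \<forall>k\<le>n. Y k \<omega> \<noteq> j} \<omega> =
      (\<Sum>i. ennreal (S n \<omega>) * indicator {\<omega> \<in> space M. (\<forall>k\<in>{0..n}. Y k \<omega> \<noteq> j) \<and> Y n \<omega> = i} \<omega>)" for \<omega>
    proof -
      have "(\<Sum>i. ennreal (S n \<omega>) * indicator {\<omega> \<in> space M. (\<forall>k\<in>{0..n}. Y k \<omega> \<noteq> j) \<and> Y n \<omega> = i} \<omega>) =
        (\<Sum>i\<in>{Y n \<omega>}. ennreal (S n \<omega>) * indicator {\<omega> \<in> space M. (\<forall>k\<in>{0..n}. Y k \<omega> \<noteq> j) \<and> Y n \<omega> = i} \<omega>)"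
        by (rule suminf_finite) (auto simp: indicator_def)
      then show ?thesis by (auto simp: indicator_def)
    qed
    show ?thesis
      unfolding ind by (subst nn_integral_suminf) (simp_all add: I)
  qed
  have "(\<Sum>n. \<Sum>i. ennreal (w i * taboo j 0 n i)) = (\<Sum>i. \<Sum>n. ennreal (w i * taboo j 0 n i))"
    by (rule suminf_swap_ennreal)
  also have "\<dots> = (\<Sum>i. ennreal (occupation j i))"
  proof (rule suminf_cong)
    fix i
    have "(\<Sum>n. ennreal (w i * taboo j 0 n i)) = ennreal (\<Sum>n. w i * taboo j 0 n i)"
      by (rule suminf_ennreal2) (use w_pos[of i] in \<open>auto intro!: mult_nonneg_nonneg taboo_nonneg summable_mult assms\<close>)
    then show "(\<Sum>n. ennreal (w i * taboo j 0 n i)) = ennreal (occupation j i)"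
      by (simp add: occupation_def suminf_mult assms)
  qed
  finally show ?thesis by (simp add: *)
qed

end

section \<open>Divergent series and detailed balance\<close>

text \<open>Eventually the terms are at most \<open>- e * c i\<close>, so a common lower bound of
  the partial sums would make \<open>c\<close> summable.\<close>

lemma partial_sum_below:
  fixes c r :: "nat \<Rightarrow> real"
  assumes c: "\<And>i. 0 \<le> c i" "\<not> summable c" and r: "eventually (\<lambda>i. r i \<le> - e) sequentially" "e > 0"
  shows "\<exists>k. (\<Sum>i<k. c i * r i) < K"
proof (rule ccontr)
  assume "\<not> ?thesis"
  then have K: "K \<le> (\<Sum>i<k. c i * r i)" for k by (auto simp: not_less)
  obtain N where N: "\<And>i. i \<ge> N \<Longrightarrow> r i \<le> - e"
    using r(1) by (auto simp: eventually_sequentially)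
  have split: "(\<Sum>i<N + n. c i * r i) = (\<Sum>i<N. c i * r i) + (\<Sum>i<n. c (i + N) * r (i + N))" for n
    by (induction n) (simp_all add: add.commute)
  have "summable (\<lambda>i. c (i + N))"
  proof (rule bounded_imp_summable)
    fix k
    have "K \<le> (\<Sum>i<N + Suc k. c i * r i)" by (rule K)
    also have "\<dots> = (\<Sum>i<N. c i * r i) + (\<Sum>i<Suc k. c (i + N) * r (i + N))"
      by (rule split)
    also have "(\<Sum>i<Suc k. c (i + N) * r (i + N)) \<le> (\<Sum>i<Suc k. c (i + N) * - e)"
      by (intro sum_mono mult_left_mono N c) simp
    also have "\<dots> = - e * (\<Sum>i\<le>k. c (i + N))"
      by (simp add: sum_distrib_left lessThan_Suc_atMost mult.commute sum_negf)
    finally show "(\<Sum>i\<le>k. c (i + N)) \<le> ((\<Sum>i<N. c i * r i) - K) / e"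
      using r(2) by (simp add: field_simps)
  qed (use c in auto)
  then show False using c(2) summable_iff_shift by blast
qed

lemma sum_triangle_swap:
  fixes g :: "nat \<Rightarrow> nat \<Rightarrow> 'a::comm_monoid_add"
  shows "(\<Sum>i<j. \<Sum>k=i..<j. g k i) = (\<Sum>k<j. \<Sum>i\<le>k. g k i)"
proof (induction j)
  case (Suc j)
  have "(\<Sum>i<Suc j. \<Sum>k=i..<Suc j. g k i) = (\<Sum>i<j. (\<Sum>k=i..<j. g k i) + g j i) + g j j"
    by simp
  also have "\<dots> = (\<Sum>i<j. \<Sum>k=i..<j. g k i) + (\<Sum>i\<le>j. g j i)"
    by (simp add: sum.distrib add.assoc lessThan_Suc_atMost[symmetric])
  finally show ?case using Suc by simp
qed simp

lemma pmf_partial_sums_tendsto: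
  fixes p :: "nat pmf"
  shows "(\<lambda>k. \<Sum>j\<le>k. pmf p j) \<longlonglongrightarrow> 1"
proof -
  have "(\<lambda>j. measure_pmf.prob p {j}) sums measure_pmf.prob p (\<Union>j. {j})"
    by (rule measure_pmf.finite_measure_UNION) (auto simp: disjoint_family_on_def)
  then have "pmf p sums 1"
    by (simp add: measure_pmf_single)
  then show ?thesis
    by (simp add: sums_def_le)
qed

context bd_rates
begin

text \<open>These are the positive multiples of the weights \<open>\<beta>\<^sub>n\<close>. As a
  predicate it covers both an explicit product, available at once, and \<open>pmf \<pi>\<close>, for
  which it is a result.\<close>

definition reversible :: "(nat \<Rightarrow> real) \<Rightarrow> bool" where
  "reversible b \<longleftrightarrow> (\<forall>i. b i > 0 \<and> mu (Suc i) * b (Suc i) = lam i * b i)"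

lemma reversible_exists: "\<exists>b. reversible b"
proof -
  let ?b = "\<lambda>n. \<Prod>i<n. lam i / mu (Suc i)"
  have "?b n > 0" for n
    by (rule prod_pos) (use lam_pos mu_pos in auto)
  moreover have "mu (Suc i) * ?b (Suc i) = lam i * ?b i" for i
    using mu_pos[of "Suc i"] by simp
  ultimately show ?thesis unfolding reversible_def by (intro exI[of _ ?b]) blast
qed

lemma reversibleD:
  assumes "reversible b"
  shows "b i > 0" "mu (Suc i) * b (Suc i) = lam i * b i"
  using assms by (auto simp: reversible_def)

text \<open>Net upward fluxes of a superinvariant vector are nonnegative and nondecreasing in the level;
  a positive one would make the vector negative far out when the series diverges.\<close>

lemma superinvariant_detailed_balance:
  assumes b: "reversible b" and div: "\<not> summable (\<lambda>k. 1 / (lam k * b k))"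
    and p: "\<And>i. 0 \<le> p i"
    and inv: "\<And>i. (if i = 0 then 0 else lam (i - 1) * p (i - 1)) + mu (Suc i) * p (Suc i)
      \<le> bd_exit_rate lam mu i * p i"
  shows "mu (Suc i) * p (Suc i) = lam i * p i"
proof -
  define J where "J = (\<lambda>i. lam i * p i - mu (Suc i) * p (Suc i))"
  have J0: "0 \<le> J 0" using inv[of 0] by (simp add: J_def bd_exit_rate_def)
  have "J i \<le> J (Suc i)" for i
    using inv[of "Suc i"] by (simp add: J_def bd_exit_rate_def algebra_simps)
  then have mono: "i \<le> k \<Longrightarrow> J i \<le> J k" for i k by (rule lift_Suc_mono_le)
  \<comment> \<open>Division by \<open>b\<close> turns the definition of \<open>J\<close> into a
    first-order recurrence for \<open>p k / b k\<close>.\<close>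
  have p_eq: "p k / b k = p 0 / b 0 + (\<Sum>i<k. 1 / (lam i * b i) * - J i)" for k
  proof (induction k)
    case (Suc k)
    have "p (Suc k) / b (Suc k) = (mu (Suc k) * p (Suc k)) / (mu (Suc k) * b (Suc k))"
      using mu_pos[of "Suc k"] by simp
    also have "\<dots> = (lam k * p k - J k) / (lam k * b k)"
      by (simp add: J_def reversibleD[OF b])
    also have "\<dots> = p k / b k + 1 / (lam k * b k) * - J k"
      using lam_pos[of k] reversibleD(1)[OF b, of k] by (simp add: field_simps)
    finally show ?case using Suc by simp
  qed simp
  have "J i = 0"
  proof (rule ccontr)
    assume "J i \<noteq> 0"
    with mono[of 0 i] J0 have pos: "J i > 0" by simp
    have "\<exists>k. (\<Sum>i<k. 1 / (lam i * b i) * - J i) < - (p 0 / b 0)"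
    proof (rule partial_sum_below[OF _ div _ pos])
      show "0 \<le> 1 / (lam i * b i)" for i using lam_pos[of i] reversibleD(1)[OF b, of i] by simp
      show "\<forall>\<^sub>F k in sequentially. - J k \<le> - J i"
        using mono[of i] by (auto simp: eventually_sequentially)
    qed
    then obtain k where "(\<Sum>i<k. 1 / (lam i * b i) * - J i) < - (p 0 / b 0)" by blast
    then have "p k / b k < 0" unfolding p_eq[of k] by linarith
    then show False using p[of k] reversibleD(1)[OF b, of k] by (simp add: field_simps)
  qed
  then show ?thesis by (simp add: J_def)
qed

end

section \<open>Descent to 0\<close>

context bd_chain
begin

text \<open>The expected time spent in state 1 before hitting 0 is finite because its product with
  \<open>mu 1\<close> is a probability, namely that of hitting 0 from above.\<close>

lemma summable_taboo_0: "summable (\<lambda>n. taboo 0 0 n i)"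
  and occupation_0_1: "mu 1 * occupation 0 1 = 1 - pmf \<nu> 0 - prob {\<omega> \<in> space M. \<forall>k. Y k \<omega> \<noteq> 0}"
proof -
  let ?L = "prob {\<omega> \<in> space M. \<forall>k. Y k \<omega> \<noteq> 0}"
  \<comment> \<open>Only state 1 leads into 0 from outside, and the taboo probability at 0 itself
    vanishes, so \<open>survival_diff\<close> leaves a single term.\<close>
  have eq: "w 1 * mu 1 * taboo 0 0 n 1 = survival 0 0 n - survival 0 0 (Suc n)" for n
    using survival_diff[of 0 n 0] by (simp add: taboo_same)
  have "(\<lambda>n. survival 0 0 n - survival 0 0 (Suc n)) sums (survival 0 0 0 - ?L)"
    using survival_tendsto[of 0 0] by (intro telescope_sums') simp
  then have sums: "(\<lambda>n. w 1 * mu 1 * taboo 0 0 n 1) sums (survival 0 0 0 - ?L)"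
    by (simp only: eq)
  have pos: "w 1 * mu 1 > 0" using w_pos[of 1] mu_pos[of 1] by simp
  have s1: "summable (\<lambda>n. taboo 0 0 n 1)"
    using sums_summable[OF sums] pos by (auto simp: summable_cmult_iff)
  \<comment> \<open>Every \<open>Suc k\<close> differs from the forbidden state 0, so summability
    climbs from neighbour to neighbour.\<close>
  have s: "summable (\<lambda>n. taboo 0 0 n (Suc k))" for k
  proof (induction k)
    case (Suc k)
    show ?case by (rule summable_taboo_neighbour[OF _ Suc]) auto
  qed (use s1 in simp)
  show "summable (\<lambda>n. taboo 0 0 n i)"
    using s by (cases i) (simp_all add: taboo_same)
  have "survival 0 0 0 = prob (space M - {\<omega> \<in> space M. Y 0 \<omega> = 0})"
    unfolding survival_def by (rule arg_cong[where f = prob]) auto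
  also have "\<dots> = 1 - pmf \<nu> 0" by (subst prob_compl) (simp_all add: initial)
  finally show "mu 1 * occupation 0 1 = 1 - pmf \<nu> 0 - ?L"
    using sums_unique[OF sums] suminf_mult[OF s1, of "w 1 * mu 1"] by (simp add: occupation_def mult_ac)
qed

lemma occupation_same: "occupation j j = 0"
  by (simp add: occupation_def taboo_same)

text \<open>The lowest edge is \<open>occupation_0_1\<close>, and each balance equation carries the
  identity one edge further up. The probability of never reaching 0 acts as an outflow at infinity,
  the same across every edge.\<close>

lemma flux_0:
  "mu (Suc k) * occupation 0 (Suc k) - lam k * occupation 0 k =
    1 - (\<Sum>i\<le>k. pmf \<nu> i) - prob {\<omega> \<in> space M. \<forall>k. Y k \<omega> \<noteq> 0}"
proof (induction k)
  case 0
  then show ?case using occupation_0_1 by (simp add: occupation_same)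
next
  case (Suc k)
  show ?case
    using occupation_balance[of "Suc k" 0] Suc summable_taboo_0
    by (simp add: bd_exit_rate_def algebra_simps)
qed

text \<open>Divided by \<open>b\<close>, the flux identity is a first-order recurrence with initial
  value \<open>occupation 0 0 = 0\<close>.\<close>

lemma occupation_0_eq:
  assumes b: "reversible b"
  shows "occupation 0 k / b k = (\<Sum>i<k. 1 / (lam i * b i) *
    (1 - (\<Sum>l\<le>i. pmf \<nu> l) - prob {\<omega> \<in> space M. \<forall>k. Y k \<omega> \<noteq> 0}))"
proof (induction k)
  case (Suc k)
  have "occupation 0 (Suc k) / b (Suc k) = (mu (Suc k) * occupation 0 (Suc k)) / (mu (Suc k) * b (Suc k))"
    using mu_pos[of "Suc k"] by simp
  also have "\<dots> = (lam k * occupation 0 k + (1 - (\<Sum>i\<le>k. pmf \<nu> i) - prob {\<omega> \<in> space M. \<forall>k. Y k \<omega> \<noteq> 0})) / (lam k * b k)"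
    using flux_0[of k] by (simp only: reversibleD(2)[OF b]) (simp add: algebra_simps)
  also have "\<dots> = occupation 0 k / b k + 1 / (lam k * b k) * (1 - (\<Sum>i\<le>k. pmf \<nu> i) - prob {\<omega> \<in> space M. \<forall>k. Y k \<omega> \<noteq> 0})"
    using lam_pos[of k] reversibleD(1)[OF b, of k] by (simp add: field_simps)
  finally show ?case using Suc by simp
qed (simp add: occupation_same)

text \<open>If 0 were missed with positive probability, then the flux would tend to a negative limit, and
  divergence of the series would make the occupation times negative.\<close>

lemma hits_0:
  assumes b: "reversible b" and div: "\<not> summable (\<lambda>k. 1 / (lam k * b k))"
  shows "prob {\<omega> \<in> space M. \<forall>k. Y k \<omega> \<noteq> 0} = 0"
proof (rule ccontr)
  let ?L = "prob {\<omega> \<in> space M. \<forall>k. Y k \<omega> \<noteq> 0}"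
  assume "?L \<noteq> 0"
  then have L: "?L > 0" by (simp add: zero_less_measure_iff)
  have "\<exists>k. (\<Sum>i<k. 1 / (lam i * b i) * (1 - (\<Sum>l\<le>i. pmf \<nu> l) - ?L)) < 0"
  proof (rule partial_sum_below[OF _ div])
    show "0 \<le> 1 / (lam i * b i)" for i using lam_pos[of i] reversibleD(1)[OF b, of i] by simp
    show "?L / 2 > 0" using L by simp
    \<comment> \<open>The tail of \<open>\<nu>\<close> falls below half the probability of missing
      0, so the flux is eventually at most minus that half.\<close>
    have "eventually (\<lambda>i. (\<Sum>l\<le>i. pmf \<nu> l) > 1 - ?L / 2) sequentially"
      by (rule order_tendstoD[OF pmf_partial_sums_tendsto]) (use L in simp)
    then show "eventually (\<lambda>i. 1 - (\<Sum>l\<le>i. pmf \<nu> l) - ?L \<le> - (?L / 2)) sequentially"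
      by eventually_elim simp
  qed
  then obtain k where "(\<Sum>i<k. 1 / (lam i * b i) * (1 - (\<Sum>l\<le>i. pmf \<nu> l) - ?L)) < 0" by blast
  then have "occupation 0 k / b k < 0" unfolding occupation_0_eq[OF b] .
  moreover have "0 \<le> occupation 0 k" by (rule occupation_nonneg[OF summable_taboo_0])
  ultimately show False using reversibleD(1)[OF b, of k] by (simp add: field_simps)
qed

end

section \<open>Recurrence forces divergence\<close>

context bd_chain
begin

text \<open>The function \<open>f\<close> below is harmonic away from 0. If it were bounded, then optional stopping
  would bound the probability of never returning to 0 away from zero.\<close>

lemma recurrent_imp_divergent:
  assumes b: "reversible b" and start: "pmf \<nu> 0 = 1"
    and rec: "prob {\<omega> \<in> space M. \<forall>k\<ge>1. Y k \<omega> \<noteq> 0} = 0"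
  shows "\<not> summable (\<lambda>k. 1 / (lam k * b k))"
proof
  assume sm: "summable (\<lambda>k. 1 / (lam k * b k))"
  have c: "0 < 1 / (lam k * b k)" for k using lam_pos[of k] reversibleD(1)[OF b, of k] by simp
  \<comment> \<open>The scale function of the chain, with \<open>f 0 = 0\<close>; by
    \<open>up\<close> and \<open>down\<close> its mean upward and downward changes cancel at every
    state other than 0.\<close>
  define f where "f = (\<lambda>i. \<Sum>k<i. 1 / (lam k * b k))"
  define K where "K = (\<Sum>k. 1 / (lam k * b k))"
  have f_nonneg: "0 \<le> f i" for i unfolding f_def by (intro sum_nonneg less_imp_le c)
  have f_le: "f i \<le> K" for i
    unfolding f_def K_def by (rule sum_le_suminf[OF sm]) (use c in \<open>auto intro: less_imp_le\<close>)
  have f0: "f 0 = 0" by (simp add: f_def)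
  have up: "lam i * (f (Suc i) - f i) = 1 / b i" for i
    using lam_pos[of i] by (simp add: f_def)
  have down: "mu (Suc i) * (f (Suc i) - f i) = 1 / b (Suc i)" for i
    using mu_pos[of "Suc i"] reversibleD[OF b, of i] by (simp add: f_def flip: reversibleD(2)[OF b])
  have harmonic: "(\<Sum>l. ennreal (step (Suc i) l) * ennreal (f l)) = ennreal (f (Suc i))" for i
  proof -
    have "(\<Sum>l. ennreal (step (Suc i) l) * ennreal (f l)) = (\<Sum>l\<in>{i, Suc i, Suc (Suc i)}. ennreal (step (Suc i) l) * ennreal (f l))"
      by (rule suminf_finite) (auto simp: step_def bd_rate_def)
    also have "\<dots> = ennreal (\<Sum>l\<in>{i, Suc i, Suc (Suc i)}. step (Suc i) l * f l)"
      by (subst sum_ennreal[symmetric]) (auto simp: ennreal_mult step_nonneg f_nonneg)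
    also have "(\<Sum>l\<in>{i, Suc i, Suc (Suc i)}. step (Suc i) l * f l) =
        f (Suc i) + w (Suc i) * (lam (Suc i) * (f (Suc (Suc i)) - f (Suc i)) - mu (Suc i) * (f (Suc i) - f i))"
      by (simp add: step_def bd_rate_def bd_exit_rate_def algebra_simps)
    also have "\<dots> = f (Suc i)" by (simp add: up down)
    finally show ?thesis .
  qed
  define U where "U = (\<lambda>n. \<Sum>i. ennreal (taboo 0 1 n i) * ennreal (f i))"
  have U_Suc: "U (Suc n) = U n" if "n \<ge> 1" for n
  proof -
    have "ennreal (taboo 0 1 (Suc n) l) * ennreal (f l) =
        (\<Sum>i. ennreal (taboo 0 1 n i) * (ennreal (step i l) * ennreal (f l)))" for l
    proof (cases "l = 0")
      case False
      then have "(\<Sum>i. ennreal (step i l * taboo 0 1 n i)) = ennreal (taboo 0 1 (Suc n) l)"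
        by (intro suminf_ennreal_eq taboo_Suc_sums mult_nonneg_nonneg step_nonneg taboo_nonneg) simp
      then show ?thesis
        by (simp add: ennreal_mult step_nonneg taboo_nonneg mult_ac flip: ennreal_suminf_multc)
    qed (simp add: f0)
    then have "U (Suc n) = (\<Sum>i. \<Sum>l. ennreal (taboo 0 1 n i) * (ennreal (step i l) * ennreal (f l)))"
      unfolding U_def by (simp only: suminf_swap_ennreal[of "\<lambda>i l. ennreal (taboo 0 1 n i) * (ennreal (step i l) * ennreal (f l))"])
    also have "\<dots> = (\<Sum>i. ennreal (taboo 0 1 n i) * (\<Sum>l. ennreal (step i l) * ennreal (f l)))"
      by simp
    also have "\<dots> = U n"
      unfolding U_def
    proof (rule suminf_cong)
      fix i
      show "ennreal (taboo 0 1 n i) * (\<Sum>l. ennreal (step i l) * ennreal (f l)) = ennreal (taboo 0 1 n i) * ennreal (f i)"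
        using that by (cases i) (simp_all add: taboo_same harmonic)
    qed
    finally show ?thesis .
  qed
  have U1: "U (Suc n) = U 1" for n
    by (induction n) (simp_all only: U_Suc One_nat_def le_add1 Suc_le_mono le0)
  have U_le: "U n \<le> ennreal (K * survival 0 1 n)" for n
  proof -
    have "U n \<le> (\<Sum>i. ennreal (K * taboo 0 1 n i))"
      unfolding U_def using f_le f_nonneg
      by (intro suminf_le) (auto simp: mult.commute taboo_nonneg simp flip: ennreal_mult
            intro!: ennreal_leI mult_right_mono)
    also have "\<dots> = ennreal (K * survival 0 1 n)"
      using order_trans[OF f_nonneg f_le]
      by (intro suminf_ennreal_eq sums_mult taboo_sums_survival) (auto simp: taboo_nonneg)
    finally show ?thesis .
  qed
  \<comment> \<open>Survival tends to 0 by recurrence, so the constant \<open>U 1\<close> is 0; yet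
    its term at state 1 is positive, as the chain can move from 0 to 1.\<close>
  have "survival 0 1 \<longlonglongrightarrow> 0" using survival_tendsto[of 0 1] rec by simp
  then have "(\<lambda>n. ennreal (K * survival 0 1 n)) \<longlonglongrightarrow> ennreal (K * 0)"
    by (intro tendsto_ennrealI tendsto_mult tendsto_const)
  then have "(\<lambda>n. ennreal (K * survival 0 1 (Suc n))) \<longlonglongrightarrow> ennreal (K * 0)"
    by (rule LIMSEQ_Suc)
  then have "U 1 \<le> ennreal (K * 0)"
    by (rule LIMSEQ_le_const) (use U_le U1 in metis)
  then have "ennreal (taboo 0 1 1 1) * ennreal (f 1) = 0"
    using sum_le_suminf[of "\<lambda>i. ennreal (taboo 0 1 1 i) * ennreal (f i)" "{1}"]
    unfolding U_def by simp
  \<comment> \<open>The range \<open>{1..0}\<close> of forbidden times is empty, so the start in 0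
    is counted.\<close>
  moreover have "taboo 0 1 0 0 = 1"
    unfolding taboo_def by (simp add: initial start)
  then have "taboo 0 1 1 1 > 0"
    using taboo_Suc[of 1 0 1 0] lam_pos[of 0] w_pos w_exit_le[of 1] taboo_nonneg mu_pos[of 2]
    by (auto intro!: add_pos_nonneg simp: numeral_2_eq_2 less_imp_le)
  moreover have "f 1 > 0" using c[of 0] by (simp add: f_def)
  ultimately show False by (simp flip: ennreal_mult add: ennreal_eq_0_iff)
qed

end

section \<open>Ascent from 0\<close>

context bd_chain
begin

context
  fixes j :: nat
  assumes start_0: "\<nu> = return_pmf 0"
begin

text \<open>Nearest-neighbour steps from 0 cannot pass above \<open>j\<close> without visiting
  it.\<close>

lemma taboo_above: "j \<le> i \<Longrightarrow> taboo j 0 n i = 0"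
proof (induction n arbitrary: i)
  case 0
  then show ?case
    using start_0 by (cases "i = j") (auto simp: taboo_same taboo_0)
next
  case (Suc n)
  then show ?case
    by (cases "i = j") (auto simp: taboo_same taboo_Suc)
qed

text \<open>By \<open>taboo_above\<close> the mass entering \<open>j\<close> comes from
  \<open>j - 1\<close> alone, so the losses of survival probability bound the visits there;
  \<open>summable_taboo_neighbour\<close> then leads down to 0.\<close>

lemma summable_taboo_up: "summable (\<lambda>n. taboo j 0 n i)"
proof (cases "i < j")
  case True
  have "(\<lambda>n. survival j 0 n - survival j 0 (Suc n)) sums (survival j 0 0 - prob {\<omega> \<in> space M. \<forall>k. Y k \<omega> \<noteq> j})"
    using survival_tendsto[of j 0] by (intro telescope_sums') simp
  then have "summable (\<lambda>n. w (j - 1) * lam (j - 1) * taboo j 0 n (j - 1))"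
    using survival_diff[of 0 _ j] True by (simp add: taboo_above sums_iff)
  then have s: "summable (\<lambda>n. taboo j 0 n (j - 1))"
    using w_pos[of "j - 1"] lam_pos[of "j - 1"] by (simp add: summable_cmult_iff)
  from True have "i \<le> j - 1" by simp
  then show ?thesis
  proof (induction rule: inc_induct)
    case (step k)
    show ?case
      by (rule summable_taboo_neighbour[OF _ step.IH]) (use step True in auto)
  qed (rule s)
qed (simp add: taboo_above)

text \<open>Unit mass enters at 0 and no other state below \<open>j\<close> is a source, so the net
  upward flux across every edge below \<open>j\<close> is 1. The recurrence is solved downwards from
  \<open>occupation j j = 0\<close>.\<close>

lemma occupation_up:
  assumes b: "reversible b" and i: "i \<le> j"
  shows "occupation j i = b i * (\<Sum>k=i..<j. 1 / (lam k * b k))"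
  using i
proof (induction rule: inc_induct)
  case (step i)
  have flux: "i < j \<Longrightarrow> lam i * occupation j i - mu (Suc i) * occupation j (Suc i) = 1" for i
  proof (induction i)
    case 0
    then show ?case
      using occupation_balance[of 0 j] summable_taboo_up start_0 by (simp add: bd_exit_rate_def)
  next
    case (Suc i)
    then show ?case
      using occupation_balance[of "Suc i" j] summable_taboo_up start_0
      by (simp add: bd_exit_rate_def algebra_simps)
  qed
  have "lam i * occupation j i = 1 + lam i * b i * (\<Sum>k=Suc i..<j. 1 / (lam k * b k))"
    using flux[OF step(2)] reversibleD(2)[OF b, of i] by (simp add: step(3) mult.assoc[symmetric])
  also have "\<dots> = lam i * (b i * (\<Sum>k=i..<j. 1 / (lam k * b k)))"
    using lam_pos[of i] reversibleD(1)[OF b, of i] step(2)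
    by (simp add: sum.atLeast_Suc_lessThan[of i j] algebra_simps)
  finally show ?case using lam_pos[of i] by simp
qed (simp add: occupation_same)

text \<open>Exchanging the sums over \<open>i \<le> k < j\<close> yields head sums of
  \<open>b\<close>; for \<open>b = pmf \<pi>\<close> these are one minus the tail.\<close>

lemma suminf_occupation_up:
  assumes b: "reversible b"
  shows "(\<Sum>i. ennreal (occupation j i)) = ennreal (\<Sum>k<j. 1 / (lam k * b k) * (\<Sum>i\<le>k. b i))"
proof -
  have "(\<Sum>i. ennreal (occupation j i)) = (\<Sum>i<j. ennreal (occupation j i))"
    by (rule suminf_finite) (auto simp: occupation_def taboo_above)
  also have "\<dots> = ennreal (\<Sum>i<j. occupation j i)"
    by (rule sum_ennreal) (rule occupation_nonneg[OF summable_taboo_up])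
  also have "(\<Sum>i<j. occupation j i) = (\<Sum>i<j. \<Sum>k=i..<j. 1 / (lam k * b k) * b i)"
    by (intro sum.cong) (auto simp: occupation_up[OF b] sum_distrib_left mult.commute)
  also have "\<dots> = (\<Sum>k<j. \<Sum>i\<le>k. 1 / (lam k * b k) * b i)"
    by (rule sum_triangle_swap)
  finally show ?thesis by (simp only: sum_distrib_left)
qed

end

end

section \<open>Mean hitting times\<close>

context bd_rates
begin

text \<open>The time models enter through three facts: hitting times as stopped sums of holding
  times, return to 0, and superinvariance of \<open>\<pi>\<close>. The last is an inequality because
  that is what the small-time limit in continuous time gives; divergence upgrades it to detailed
  balance.\<close>

lemma mean_hitting_formulas:
  fixes P :: "nat pmf \<Rightarrow> 'w measure" and \<pi> :: "nat pmf"
  assumes chain: "\<And>\<nu> j. \<exists>Y S. bd_chain lam mu w (P \<nu>) Y S \<nu> \<and> mean_hitting_time T P X \<nu> j =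
      (\<Sum>n. \<integral>\<^sup>+\<omega>. ennreal (S n \<omega>) * indicator {\<omega> \<in> space (P \<nu>). \<forall>k\<le>n. Y k \<omega> \<noteq> j} \<omega> \<partial>P \<nu>)"
    and recurrent: "\<exists>Y S. bd_chain lam mu w (P (return_pmf 0)) Y S (return_pmf 0) \<and>
      measure (P (return_pmf 0)) {\<omega> \<in> space (P (return_pmf 0)). \<forall>k\<ge>1. Y k \<omega> \<noteq> 0} = 0"
    and inv: "\<And>i. (if i = 0 then 0 else lam (i - 1) * pmf \<pi> (i - 1)) + mu (Suc i) * pmf \<pi> (Suc i)
      \<le> bd_exit_rate lam mu i * pmf \<pi> i"
  shows "(K_prime T P X \<pi> < \<infinity> \<longleftrightarrow> Theta lam \<pi> < \<infinity>) \<and>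
    (Theta lam \<pi> < \<infinity> \<longrightarrow>
       K_prime T P X \<pi> = Theta lam \<pi> - mean_hitting_time T P X \<pi> 0 \<and>
       mean_hitting_time T P X \<pi> 0 =
         (\<Sum>k. ennreal (inverse (lam k * pmf \<pi> k) * (\<Sum>\<^sub>\<infinity>j\<in>{k+1..}. pmf \<pi> j)\<^sup>2)) \<and>
       mean_hitting_time T P X \<pi> 0 < Theta lam \<pi>)"
proof -
  obtain b where b: "reversible b" using reversible_exists by blast
  have div: "\<not> summable (\<lambda>k. 1 / (lam k * b k))"
    using recurrent bd_chain.recurrent_imp_divergent[OF _ b] by fastforce
  have db: "mu (Suc i) * pmf \<pi> (Suc i) = lam i * pmf \<pi> i" for i
    by (rule superinvariant_detailed_balance[OF b div _ inv]) simp
  \<comment> \<open>If \<open>\<pi>\<close> vanished at 0, detailed balance would make it vanish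
    everywhere.\<close>
  have pos: "pmf \<pi> i > 0" for i
  proof (induction i)
    case 0
    show ?case
    proof (rule ccontr)
      assume "\<not> ?thesis"
      then have "pmf \<pi> 0 = 0" using pmf_nonneg[of \<pi> 0] by linarith
      have "pmf \<pi> i = 0" for i
      proof (induction i)
        case (Suc i)
        then show ?case using db[of i] mu_pos[of "Suc i"] by simp
      qed fact
      then show False using pmf_partial_sums_tendsto[of \<pi>] LIMSEQ_unique by fastforce
    qed
  next
    case (Suc i)
    then show ?case
      using db[of i] mu_pos[of "Suc i"] lam_pos[of i] by (metis less_eq_Suc_le mult_pos_pos zero_less_mult_pos zero_less_Suc One_nat_def)
  qed
  have rev: "reversible (pmf \<pi>)" by (simp add: reversible_def pos db)
  define c where "c = (\<lambda>k. 1 / (lam k * pmf \<pi> k))"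
  define t where "t = (\<lambda>k. 1 - (\<Sum>j\<le>k. pmf \<pi> j))"
  have c_pos: "c k > 0" for k using lam_pos[of k] pos[of k] by (simp add: c_def)
  have t_nonneg: "0 \<le> t k" for k by (simp add: t_def pmf_tail(3))
  have head: "(\<Sum>j\<le>k. pmf \<pi> j) = 1 - t k" for k by (simp add: t_def)
  have t_le: "t k \<le> 1 - pmf \<pi> 0" for k
    using member_le_sum[of 0 "{..k}" "pmf \<pi>"] by (simp add: t_def)
  \<comment> \<open>Positivity of the first tail is the source of the strict inequality.\<close>
  have t0: "t 0 > 0"
  proof -
    have "pmf \<pi> 0 + pmf \<pi> 1 \<le> 1" using pmf_tail(3)[of \<pi> 1] by simp
    then show ?thesis using pos[of 1] by (simp add: t_def)
  qed
  have tail: "(\<Sum>i. ennreal (pmf \<pi> (i + Suc k))) = ennreal (t k)" for k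
    by (simp only: pmf_tail(2) t_def)
  have swap: "(\<Sum>i. ennreal (pmf \<pi> i) * ennreal (\<Sum>k<i. g k)) = (\<Sum>k. ennreal (g k * t k))"
    if "\<And>k. 0 \<le> g k" for g
  proof -
    have "(\<Sum>i. ennreal (pmf \<pi> i) * ennreal (\<Sum>k<i. g k)) = (\<Sum>i. ennreal (pmf \<pi> i) * (\<Sum>k<i. ennreal (g k)))"
      by (simp add: that)
    then show ?thesis
      unfolding suminf_triangle_ennreal tail by (simp add: that ennreal_mult t_nonneg)
  qed
  have Theta: "Theta lam \<pi> = (\<Sum>k. ennreal (c k * t k))"
    unfolding Theta_def pmf_tail(1) c_def t_def by (simp add: inverse_eq_divide)
  have up: "mean_hitting_time T P X (return_pmf 0) j = ennreal (\<Sum>k<j. c k * (1 - t k))" for j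
  proof -
    obtain Y S where Y: "bd_chain lam mu w (P (return_pmf 0)) Y S (return_pmf 0)"
      "mean_hitting_time T P X (return_pmf 0) j =
      (\<Sum>n. \<integral>\<^sup>+\<omega>. ennreal (S n \<omega>) * indicator {\<omega> \<in> space (P (return_pmf 0)). \<forall>k\<le>n. Y k \<omega> \<noteq> j} \<omega> \<partial>P (return_pmf 0))"
      using chain[of "return_pmf 0" j] by blast
    interpret bd_chain lam mu w "P (return_pmf 0)" Y S "return_pmf 0" by (rule Y(1))
    show ?thesis
      unfolding Y(2) nn_integral_holding[OF summable_taboo_up[OF refl]]
        suminf_occupation_up[OF refl rev] by (simp add: c_def head)
  qed
  have K: "K_prime T P X \<pi> = (\<Sum>k. ennreal (c k * (1 - t k) * t k))"
    unfolding K_prime_def up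
  proof (rule swap)
    show "0 \<le> c k * (1 - t k)" for k
      using c_pos[of k] t_le[of k] pos[of 0] by simp
  qed
  have E: "mean_hitting_time T P X \<pi> 0 = (\<Sum>k. ennreal (c k * (t k)\<^sup>2))"
  proof -
    obtain Y S where Y: "bd_chain lam mu w (P \<pi>) Y S \<pi>"
      "mean_hitting_time T P X \<pi> 0 =
      (\<Sum>n. \<integral>\<^sup>+\<omega>. ennreal (S n \<omega>) * indicator {\<omega> \<in> space (P \<pi>). \<forall>k\<le>n. Y k \<omega> \<noteq> 0} \<omega> \<partial>P \<pi>)"
      using chain[of \<pi> 0] by blast
    interpret bd_chain lam mu w "P \<pi>" Y S \<pi> by (rule Y(1))
    \<comment> \<open>0 is hit almost surely, so the flux in \<open>occupation_0_eq\<close> is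
      exactly the tail \<open>t k\<close>.\<close>
    have occ: "occupation 0 i = pmf \<pi> i * (\<Sum>k<i. c k * t k)" for i
      using occupation_0_eq[OF rev, of i] hits_0[OF b div] pos[of i]
      by (simp add: c_def t_def field_simps)
    have "(\<Sum>i. ennreal (occupation 0 i)) = (\<Sum>i. ennreal (pmf \<pi> i) * ennreal (\<Sum>k<i. c k * t k))"
      by (simp add: occ ennreal_mult' )
    also have "\<dots> = (\<Sum>k. ennreal (c k * t k * t k))"
      by (rule swap) (use c_pos t_nonneg in \<open>simp add: less_imp_le\<close>)
    finally show ?thesis
      unfolding Y(2) nn_integral_holding[OF summable_taboo_0] by (simp add: power2_eq_square mult.assoc)
  qed
  have sum: "K_prime T P X \<pi> + mean_hitting_time T P X \<pi> 0 = Theta lam \<pi>"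
  proof -
    have "ennreal (c k * (1 - t k) * t k) + ennreal (c k * (t k)\<^sup>2) = ennreal (c k * t k)" for k
    proof -
      have "0 \<le> c k * (1 - t k) * t k" "0 \<le> c k * (t k)\<^sup>2"
        using c_pos[of k] t_le[of k] pos[of 0] t_nonneg[of k] by simp_all
      then show ?thesis
        by (subst ennreal_plus[symmetric]) (simp_all add: algebra_simps power2_eq_square)
    qed
    then show ?thesis
      unfolding K E Theta by (subst suminf_add) auto
  qed
  \<comment> \<open>The bound \<open>pmf \<pi> 0 \<le> 1 - t k\<close>, uniform in \<open>k\<close>,
    makes finiteness of \<open>K_prime\<close> imply that of \<open>Theta\<close>.\<close>
  have K_ge: "ennreal (pmf \<pi> 0) * Theta lam \<pi> \<le> K_prime T P X \<pi>"
    unfolding K Theta ennreal_suminf_cmult[symmetric]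
  proof (rule suminf_le)
    show "ennreal (pmf \<pi> 0) * ennreal (c k * t k) \<le> ennreal (c k * (1 - t k) * t k)" for k
    proof -
      have "pmf \<pi> 0 * (c k * t k) \<le> (1 - t k) * (c k * t k)"
        using c_pos[of k] t_le[of k] t_nonneg[of k] by (intro mult_right_mono) auto
      then have "ennreal (pmf \<pi> 0 * (c k * t k)) \<le> ennreal (c k * (1 - t k) * t k)"
        by (intro ennreal_leI) (simp add: mult_ac)
      then show ?thesis by (simp add: ennreal_mult')
    qed
  qed auto
  have K_pos: "0 < K_prime T P X \<pi>"
  proof -
    have "Theta lam \<pi> \<ge> ennreal (c 0 * t 0)"
      unfolding Theta using sum_le_suminf[of "\<lambda>k. ennreal (c k * t k)" "{0}"] by simp
    moreover have "ennreal (c 0 * t 0) > 0" using c_pos[of 0] t0 by simp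
    ultimately have "Theta lam \<pi> > 0" by (rule less_le_trans[rotated])
    then have "ennreal (pmf \<pi> 0) * Theta lam \<pi> > 0"
      using pos[of 0] by (simp add: ennreal_zero_less_mult_iff)
    then show ?thesis using K_ge by (rule less_le_trans)
  qed
  have iff: "K_prime T P X \<pi> < \<infinity> \<longleftrightarrow> Theta lam \<pi> < \<infinity>"
  proof
    assume "K_prime T P X \<pi> < \<infinity>"
    then have "ennreal (pmf \<pi> 0) * Theta lam \<pi> < \<infinity>" using K_ge by (rule le_less_trans[rotated])
    then show "Theta lam \<pi> < \<infinity>"
      using pos[of 0] by (auto simp: ennreal_mult_less_top)
  next
    assume "Theta lam \<pi> < \<infinity>"
    then show "K_prime T P X \<pi> < \<infinity>" unfolding sum[symmetric] by (simp add: ennreal_add_less_top)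
  qed
  moreover have "K_prime T P X \<pi> = Theta lam \<pi> - mean_hitting_time T P X \<pi> 0 \<and>
      mean_hitting_time T P X \<pi> 0 < Theta lam \<pi>" if "Theta lam \<pi> < \<infinity>"
  proof -
    \<comment> \<open>Subtraction in \<open>ennreal\<close> cancels only a finite summand.\<close>
    have "mean_hitting_time T P X \<pi> 0 \<noteq> top"
      using that unfolding sum[symmetric] by (auto simp: ennreal_add_less_top)
    then show ?thesis
      using K_pos unfolding sum[symmetric]
      by (simp add: ennreal_add_diff_cancel_right)
  qed
  moreover have "(\<Sum>k. ennreal (c k * (t k)\<^sup>2)) =
      (\<Sum>k. ennreal (inverse (lam k * pmf \<pi> k) * (\<Sum>\<^sub>\<infinity>j\<in>{k+1..}. pmf \<pi> j)\<^sup>2))"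
    unfolding pmf_tail(1) c_def t_def by (simp add: inverse_eq_divide)
  ultimately show ?thesis using E by simp
qed

end

section \<open>The two time models\<close>

text \<open>Layer-cake formula: the integral of the positive part of \<open>S\<close> over
  \<open>A\<close> is that of its tail over \<open>s \<ge> 0\<close>, and this tail is
  \<open>C / q\<close> times the exponential density, whose total mass is 1.\<close>

lemma nn_integral_exponential_tail:
  assumes "finite_measure M" and [measurable]: "S \<in> borel_measurable M" "A \<in> sets M"
    and q: "q > 0" and C: "C \<ge> 0"
    and tail: "\<And>s. s \<ge> 0 \<Longrightarrow> measure M {\<omega> \<in> A. s < S \<omega>} = C * exp (- q * s)"
  shows "(\<integral>\<^sup>+\<omega>. ennreal (S \<omega>) * indicator A \<omega> \<partial>M) = ennreal (C / q)"
proof -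
  interpret finite_measure M by fact
  interpret pair_sigma_finite M lborel
    by (intro pair_sigma_finite.intro sigma_finite_measure_axioms lborel.sigma_finite_measure_axioms)
  let ?F = "\<lambda>\<omega> s :: real. indicator {0..} s * (indicator {s. s < S \<omega>} s * indicator A \<omega>) :: ennreal"
  have "(\<integral>\<^sup>+s. ?F \<omega> s \<partial>lborel) = ennreal (S \<omega>) * indicator A \<omega>" for \<omega>
  proof -
    have "(\<integral>\<^sup>+s. ?F \<omega> s \<partial>lborel) = (\<integral>\<^sup>+s. indicator {0..<S \<omega>} s * indicator A \<omega> \<partial>lborel)"
      by (intro nn_integral_cong) (auto simp: indicator_def)
    also have "\<dots> = emeasure lborel {0..<S \<omega>} * indicator A \<omega>"
      by (subst nn_integral_multc) simp_all
    finally show ?thesis by (cases "0 \<le> S \<omega>") (simp_all add: ennreal_neg)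
  qed
  then have "(\<integral>\<^sup>+\<omega>. ennreal (S \<omega>) * indicator A \<omega> \<partial>M) = (\<integral>\<^sup>+\<omega>. \<integral>\<^sup>+s. ?F \<omega> s \<partial>lborel \<partial>M)"
    by simp
  also have "\<dots> = (\<integral>\<^sup>+s. \<integral>\<^sup>+\<omega>. ?F \<omega> s \<partial>M \<partial>lborel)"
    by (rule Fubini'[symmetric]) measurable
  also have "\<dots> = (\<integral>\<^sup>+s. ennreal (C / q) * ennreal (exponential_density q s) \<partial>lborel)"
  proof (rule nn_integral_cong)
    fix s :: real
    have "(\<integral>\<^sup>+\<omega>. ?F \<omega> s \<partial>M) = indicator {0..} s * (\<integral>\<^sup>+\<omega>. indicator {\<omega> \<in> A. s < S \<omega>} \<omega> \<partial>M)"
      by (subst nn_integral_cmult[symmetric]) (auto intro!: nn_integral_cong simp: indicator_def)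
    also have "(\<integral>\<^sup>+\<omega>. indicator {\<omega> \<in> A. s < S \<omega>} \<omega> \<partial>M) = ennreal (measure M {\<omega> \<in> A. s < S \<omega>})"
      by (simp add: emeasure_eq_measure)
    also have "indicator {0..} s * \<dots> = ennreal (C / q) * ennreal (exponential_density q s)"
    proof (cases "0 \<le> s")
      case True
      then have "ennreal (C * exp (- q * s)) = ennreal (C / q * (q * exp (- s * q)))"
        using q by (intro arg_cong[where f = ennreal]) (simp add: mult_ac)
      also have "\<dots> = ennreal (C / q) * ennreal (q * exp (- s * q))"
        using q C by (intro ennreal_mult) auto
      finally show ?thesis using True by (simp add: exponential_density_def tail)
    qed (simp add: exponential_density_def)
    finally show "(\<integral>\<^sup>+\<omega>. ?F \<omega> s \<partial>M) = ennreal (C / q) * ennreal (exponential_density q s)" .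
  qed
  also have "\<dots> = ennreal (C / q) * (\<integral>\<^sup>+s. ennreal (exponential_density q s) \<partial>lborel)"
    by (rule nn_integral_cmult) simp
  also have "(\<integral>\<^sup>+s. ennreal (exponential_density q s) \<partial>lborel) = 1"
    using prob_space.emeasure_space_1[OF prob_space_exponential_density[OF q]]
    by (simp add: emeasure_density)
  finally show ?thesis by simp
qed

lemma jump_index_unique:
  fixes S :: "nat \<Rightarrow> real"
  assumes S: "\<And>n. 0 < S n"
    and n: "(\<Sum>k<n. S k) \<le> t" "t < (\<Sum>k<Suc n. S k)" and m: "(\<Sum>k<m. S k) \<le> t" "t < (\<Sum>k<Suc m. S k)"
  shows "n = m"
proof -
  have mono: "a \<le> b \<Longrightarrow> (\<Sum>k<a. S k) \<le> (\<Sum>k<b. S k)" for a b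
    by (rule sum_mono2) (use S in \<open>auto intro: less_imp_le\<close>)
  show ?thesis
    using mono[of "Suc n" m] mono[of "Suc m" n] n m by (cases n m rule: linorder_cases) auto
qed

text \<open>The infimum is attained at the start of the first holding interval whose state is
  \<open>j\<close>. If \<open>j\<close> is never visited both sides are infinite, since intervals
  covering all times cannot have a finite total length.\<close>

lemma hitting_time_jump:
  assumes S: "\<And>n. 0 < S n"
    and cover: "\<And>t. t \<in> time_set T \<Longrightarrow> \<exists>n. (\<Sum>k<n. S k) \<le> t \<and> t < (\<Sum>k<Suc n. S k) \<and> X t \<omega> = Y n"
    and jumps: "\<And>n. (\<Sum>k<n. S k) \<in> time_set T"
  shows "hitting_time T X j \<omega> = (\<Sum>n. ennreal (S n) * (if \<forall>k\<le>n. Y k \<noteq> j then 1 else 0))"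
proof -
  have mono: "a \<le> b \<Longrightarrow> (\<Sum>k<a. S k) \<le> (\<Sum>k<b. S k)" for a b
    by (rule sum_mono2) (use S in \<open>auto intro: less_imp_le\<close>)
  show ?thesis
  proof (cases "\<exists>n. Y n = j")
    case True
    define N where "N = (LEAST n. Y n = j)"
    have N: "Y N = j" unfolding N_def using True by (rule LeastI_ex)
    have less: "Y n \<noteq> j" if "n < N" for n using not_less_Least that unfolding N_def by blast
    have iff: "(\<forall>k\<le>n. Y k \<noteq> j) \<longleftrightarrow> n < N" for n
      using N less by (metis le_less_trans not_le)
    have "(\<Sum>n. ennreal (S n) * (if \<forall>k\<le>n. Y k \<noteq> j then 1 else 0)) = (\<Sum>n<N. ennreal (S n))"
      unfolding iff by (subst suminf_finite[of "{..<N}"]) auto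
    also have "\<dots> = ennreal (\<Sum>n<N. S n)"
      by (simp add: S less_imp_le)
    also have "\<dots> = hitting_time T X j \<omega>"
      unfolding hitting_time_def
    proof (rule antisym)
      show "ennreal (\<Sum>n<N. S n) \<le> Inf (ennreal ` {t \<in> time_set T. X t \<omega> = j})"
      proof (rule Inf_greatest, clarify)
        fix t assume t: "t \<in> time_set T" "j = X t \<omega>"
        then obtain n where n: "(\<Sum>k<n. S k) \<le> t" "X t \<omega> = Y n" using cover by blast
        then have "N \<le> n" using less t by (metis not_le)
        then have "(\<Sum>k<N. S k) \<le> t" using mono n(1) order_trans by blast
        then show "ennreal (\<Sum>n<N. S n) \<le> ennreal t" by (rule ennreal_leI)
      qed
      obtain n where n: "(\<Sum>k<n. S k) \<le> (\<Sum>k<N. S k)" "(\<Sum>k<N. S k) < (\<Sum>k<Suc n. S k)"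
        "X (\<Sum>k<N. S k) \<omega> = Y n"
        using cover[OF jumps[of N]] by blast
      have "n = N" by (rule jump_index_unique[OF S n(1,2)]) (use S in auto)
      then show "Inf (ennreal ` {t \<in> time_set T. X t \<omega> = j}) \<le> ennreal (\<Sum>n<N. S n)"
        using n(3) N jumps by (intro Inf_lower) auto
    qed
    finally show ?thesis ..
  next
    case False
    then have "{t \<in> time_set T. X t \<omega> = j} = {}" using cover by force
    then have "hitting_time T X j \<omega> = top"
      unfolding hitting_time_def by (simp only: image_empty Inf_empty)
    moreover have "(\<Sum>n. ennreal (S n)) = top"
    proof (rule ccontr)
      assume "(\<Sum>n. ennreal (S n)) \<noteq> top"
      then have sm: "summable S" using summable_suminf_not_top[of S] S by (simp add: less_imp_le)
      \<comment> \<open>A time of the model beyond the supposed finite total length lies in no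
        holding interval.\<close>
      obtain r where r: "r \<in> time_set T" "(\<Sum>n. S n) \<le> r"
        using reals_Archimedean2[of "\<Sum>n. S n"] that[of "real _"]
        by (cases T) (auto intro: less_imp_le)
      obtain n where "r < (\<Sum>k<Suc n. S k)" using cover[OF r(1)] by blast
      also have "\<dots> \<le> (\<Sum>n. S n)"
        by (rule sum_le_suminf[OF sm]) (use S in \<open>auto intro: less_imp_le\<close>)
      finally show False using r(2) by simp
    qed
    ultimately show ?thesis using False by simp
  qed
qed

text \<open>Otherwise the integral would already be infinite on the event. With \<open>R\<close> a
  return time, this turns a finite mean return time into almost sure return.\<close>

lemma null_set_of_infinite:
  assumes "finite_measure M" and N: "{\<omega> \<in> space M. Q \<omega>} \<in> sets M" and AE: "AE \<omega> in M. Q \<omega> \<longrightarrow> R \<omega> = (\<infinity>::ennreal)"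
    and fin: "(\<integral>\<^sup>+\<omega>. R \<omega> \<partial>M) < \<infinity>"
  shows "measure M {\<omega> \<in> space M. Q \<omega>} = 0"
proof -
  let ?N = "{\<omega> \<in> space M. Q \<omega>}"
  have "\<infinity> * emeasure M ?N = (\<integral>\<^sup>+\<omega>. \<infinity> * indicator ?N \<omega> \<partial>M)"
    using N by (simp add: nn_integral_cmult)
  also have "\<dots> \<le> (\<integral>\<^sup>+\<omega>. R \<omega> \<partial>M)"
    by (rule nn_integral_mono_AE) (use AE in \<open>eventually_elim, auto simp: indicator_def\<close>)
  finally have "\<infinity> * emeasure M ?N < \<infinity>" using fin by (rule le_less_trans)
  then have "emeasure M ?N = 0" by (auto simp: ennreal_mult_less_top)
  then show ?thesis by (simp add: measure_def)
qed

lemma (in bd_rates) exit_rate_pos: "bd_exit_rate lam mu i > 0"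
  using lam_pos[of i] mu_pos[of i] by (cases i) (auto simp: bd_exit_rate_def intro: add_pos_pos)

lemma (in bd_rates) step_sums_1: "(\<lambda>j. step i j) sums 1"
proof -
  have "(\<lambda>j. step i j) sums (\<Sum>j\<in>{i - 1, i, Suc i}. step i j)"
    by (rule sums_finite) (auto simp: step_def bd_rate_def)
  also have "(\<Sum>j\<in>{i - 1, i, Suc i}. step i j) = 1"
    by (cases i) (auto simp: step_def bd_rate_def bd_exit_rate_def algebra_simps)
  finally show ?thesis .
qed

text \<open>With \<open>m = 1\<close> and \<open>n = 0\<close> the range of forbidden times is
  empty, so \<open>taboo_sums_next\<close> describes the unrestricted one-step law.\<close>

lemma (in bd_chain) one_step:
  "prob {\<omega> \<in> space M. Y 1 \<omega> = i} = (if i = 0 then 0 else w (i - 1) * lam (i - 1) * pmf \<nu> (i - 1)) +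
    (1 - w i * bd_exit_rate lam mu i) * pmf \<nu> i + w (Suc i) * mu (Suc i) * pmf \<nu> (Suc i)"
proof (rule step_sums)
  show "(\<lambda>k. step k i * pmf \<nu> k) sums prob {\<omega> \<in> space M. Y 1 \<omega> = i}"
    using taboo_sums_next[of i 0 1 0] by (simp add: taboo_def initial)
qed

section \<open>Embedded chains\<close>

lemma bd_discrete_chain:
  fixes P :: "nat pmf \<Rightarrow> 'w measure"
  assumes lam: "\<And>n. lam n > 0" and mu: "\<And>n. n \<ge> 1 \<Longrightarrow> mu n > 0"
    and disc: "\<And>\<nu>. bd_discrete lam mu \<nu> (P \<nu>) X"
  shows "bd_chain lam mu (\<lambda>_. 1) (P \<nu>) (\<lambda>n. X (real n)) (\<lambda>_ _. 1) \<nu>"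
proof -
  \<comment> \<open>\<open>1 - bd_exit_rate lam mu i\<close> is the probability of staying in
    \<open>i\<close> for one step under the law started at \<open>i\<close>, hence
    nonnegative.\<close>
  have "bd_exit_rate lam mu i \<le> 1" for i
  proof -
    let ?M = "P (return_pmf i)"
    have "0 \<le> measure ?M {\<omega> \<in> space ?M. \<forall>k\<le>Suc 0. X (real k) \<omega> = i}" by simp
    also have "\<dots> = measure ?M {\<omega> \<in> space ?M. \<forall>k\<le>0. X (real k) \<omega> = i} * (1 - bd_exit_rate lam mu i)"
      using disc[of "return_pmf i", unfolded bd_discrete_def] by (auto dest!: spec[of _ 0] spec[of _ "\<lambda>_. i"])
    also have "measure ?M {\<omega> \<in> space ?M. \<forall>k\<le>0. X (real k) \<omega> = i} = 1"
      using disc[of "return_pmf i", unfolded bd_discrete_def] by simp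
    finally show ?thesis by simp
  qed
  then interpret bd_rates lam mu "\<lambda>_. 1"
    by unfold_locales (use lam mu in auto)
  interpret prob_space "P \<nu>" using disc[of \<nu>] by (simp add: bd_discrete_def)
  show ?thesis
  proof
    show [measurable]: "X (real n) \<in> measurable (P \<nu>) (count_space UNIV)" for n
      using disc[of \<nu>] by (simp add: bd_discrete_def)
    show "prob {\<omega> \<in> space (P \<nu>). X (real 0) \<omega> = i} = pmf \<nu> i" for i
      using disc[of \<nu>] by (simp add: bd_discrete_def)
    show "prob {\<omega> \<in> space (P \<nu>). \<forall>k\<le>Suc n. X (real k) \<omega> = x k} =
      prob {\<omega> \<in> space (P \<nu>). \<forall>k\<le>n. X (real k) \<omega> = x k} * step (x n) (x (Suc n))" for n x
      using disc[of \<nu>] unfolding bd_discrete_def step_def by simp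
    show "(\<integral>\<^sup>+\<omega>. ennreal 1 * indicator {\<omega> \<in> space (P \<nu>). \<forall>k\<le>n. X (real k) \<omega> = x k} \<omega> \<partial>P \<nu>) =
      ennreal 1 * emeasure (P \<nu>) {\<omega> \<in> space (P \<nu>). \<forall>k\<le>n. X (real k) \<omega> = x k}" for n x
      by simp
  qed simp
qed

text \<open>With unit holding times the interval of index \<open>n\<close> contains just one natural
  time, \<open>n\<close> itself.\<close>

lemma hitting_time_Discrete:
  "hitting_time Discrete X j \<omega> = (\<Sum>n. if \<forall>k\<le>n. X (real k) \<omega> \<noteq> j then 1 else 0)"
  using hitting_time_jump[of "\<lambda>_. 1" Discrete X \<omega> "\<lambda>n. X (real n) \<omega>" j]
  by (force simp: Nats_def)

text \<open>The one- and two-state laws are those used for lower bounds on the law of \<open>X t\<close> for small \<open>t\<close>.\<close>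

lemma bd_continuous_chain:
  fixes M :: "'w measure"
  assumes lam: "\<And>n. lam n > 0" and mu: "\<forall>n\<ge>1. mu n > 0"
    and cont: "bd_continuous lam mu \<nu> M X"
  shows "\<exists>Y S. bd_chain lam mu (\<lambda>i. 1 / bd_exit_rate lam mu i) M Y S \<nu> \<and>
    (AE \<omega> in M. (\<forall>n. 0 < S n \<omega>) \<and>
      (\<forall>t\<ge>0. \<exists>n. (\<Sum>k<n. S k \<omega>) \<le> t \<and> t < (\<Sum>k<Suc n. S k \<omega>) \<and> X t \<omega> = Y n \<omega>)) \<and>
    (\<forall>s\<ge>0. \<forall>j. measure M {\<omega> \<in> space M. Y 0 \<omega> = j \<and> s < S 0 \<omega>} =
      pmf \<nu> j * exp (- bd_exit_rate lam mu j * s)) \<and>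
    (\<forall>s\<ge>0. \<forall>t\<ge>0. \<forall>i j.
      measure M {\<omega> \<in> space M. Y 0 \<omega> = i \<and> Y 1 \<omega> = j \<and> s < S 0 \<omega> \<and> t < S 1 \<omega>} =
      pmf \<nu> i * exp (- bd_exit_rate lam mu i * s) *
        (bd_rate lam mu i j / bd_exit_rate lam mu i) * exp (- bd_exit_rate lam mu j * t))"
proof -
  let ?q = "bd_exit_rate lam mu"
  have q: "?q i > 0" for i
    using lam[of i] mu[rule_format, of i] by (cases i) (auto simp: bd_exit_rate_def intro: add_pos_pos)
  interpret bd_rates lam mu "\<lambda>i. 1 / ?q i"
  proof
    show "1 / ?q n * ?q n \<le> 1" for n using q[of n] by simp
  qed (use lam mu q in auto)
  have step: "step i j = bd_rate lam mu i j / ?q i" for i j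
    using q[of i] by (simp add: step_def bd_rate_def)
  interpret prob_space M using cont by (simp add: bd_continuous_def)
  obtain Y S where
    Y': "\<forall>n. Y n \<in> measurable M (count_space UNIV)"
    and S': "\<forall>n. S n \<in> borel_measurable M"
    and init': "\<forall>i. prob {\<omega> \<in> space M. Y 0 \<omega> = i} = pmf \<nu> i"
    and law0: "\<forall>n y s. (\<forall>k. 0 \<le> s k) \<longrightarrow>
           prob {\<omega> \<in> space M. (\<forall>k\<le>Suc n. Y k \<omega> = y k) \<and> (\<forall>k<Suc n. s k < S k \<omega>)} =
           prob {\<omega> \<in> space M. (\<forall>k\<le>n. Y k \<omega> = y k) \<and> (\<forall>k<n. s k < S k \<omega>)} *
           (exp (- ?q (y n) * s n) * (bd_rate lam mu (y n) (y (Suc n)) / ?q (y n)))"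
    and cover: "AE \<omega> in M. \<forall>t\<ge>0. \<exists>n. (\<Sum>k<n. S k \<omega>) \<le> t \<and> t < (\<Sum>k<Suc n. S k \<omega>) \<and> X t \<omega> = Y n \<omega>"
    using cont unfolding bd_continuous_def by (elim conjE exE) (rule that)
  have Y[measurable]: "Y n \<in> measurable M (count_space UNIV)"
    and S[measurable]: "S n \<in> borel_measurable M"
    and init: "prob {\<omega> \<in> space M. Y 0 \<omega> = i} = pmf \<nu> i" for n i
    using Y' S' init' by auto
  have law: "prob {\<omega> \<in> space M. (\<forall>k\<le>Suc n. Y k \<omega> = y k) \<and> (\<forall>k<Suc n. s k < S k \<omega>)} =
      prob {\<omega> \<in> space M. (\<forall>k\<le>n. Y k \<omega> = y k) \<and> (\<forall>k<n. s k < S k \<omega>)} *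
      (exp (- ?q (y n) * s n) * step (y n) (y (Suc n)))" if "\<And>k. 0 \<le> s k" for n y s
    unfolding step using law0 that by blast
  \<comment> \<open>Summing over the value of \<open>Y (Suc n)\<close> removes it, since the rows of
    \<open>step\<close> sum to 1; what remains is the exponential law of \<open>S n\<close> given
    the past.\<close>
  have tail: "prob {\<omega> \<in> space M. (\<forall>k\<le>n. Y k \<omega> = y k) \<and> (\<forall>k<Suc n. s k < S k \<omega>)} =
      prob {\<omega> \<in> space M. (\<forall>k\<le>n. Y k \<omega> = y k) \<and> (\<forall>k<n. s k < S k \<omega>)} *
      exp (- ?q (y n) * s n)" if s: "\<And>k. 0 \<le> s k" for n y s
  proof -
    let ?C = "prob {\<omega> \<in> space M. (\<forall>k\<le>n. Y k \<omega> = y k) \<and> (\<forall>k<n. s k < S k \<omega>)} * exp (- ?q (y n) * s n)"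
    let ?A = "\<lambda>j. {\<omega> \<in> space M. ((\<forall>k\<le>n. Y k \<omega> = y k) \<and> (\<forall>k<Suc n. s k < S k \<omega>)) \<and> Y (Suc n) \<omega> = j}"
    have "prob (?A j) = ?C * step (y n) j" for j
    proof -
      have A: "?A j = {\<omega> \<in> space M. (\<forall>k\<le>Suc n. Y k \<omega> = (y(Suc n := j)) k) \<and> (\<forall>k<Suc n. s k < S k \<omega>)}"
        by (auto simp: le_Suc_eq)
      have B: "(\<forall>k\<le>n. Y k \<omega> = (y(Suc n := j)) k) \<longleftrightarrow> (\<forall>k\<le>n. Y k \<omega> = y k)" for \<omega>
        by auto
      show ?thesis
        unfolding A using law[of s n "y(Suc n := j)", OF s] unfolding B by simp
    qed
    then have "(\<lambda>j. prob (?A j)) sums (?C * 1)"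
      by (simp only:) (intro sums_mult step_sums_1)
    moreover have "(\<lambda>j. prob (?A j)) sums prob (\<Union>j. ?A j)"
      by (rule finite_measure_UNION) (auto simp: disjoint_family_on_def)
    moreover have "(\<Union>j. ?A j) = {\<omega> \<in> space M. (\<forall>k\<le>n. Y k \<omega> = y k) \<and> (\<forall>k<Suc n. s k < S k \<omega>)}"
      by auto
    ultimately show ?thesis by (simp only: mult_1_right) (rule sums_unique2)
  qed
  \<comment> \<open>Even with all thresholds 0 the law carries the conditions
    \<open>0 < S k\<close>. They hold almost surely, by induction over the holding times, and
    \<open>drop_pos\<close> then removes them.\<close>
  have pos_n: "prob {\<omega> \<in> space M. \<forall>k<n. 0 < S k \<omega>} = 1" for n
  proof (induction n)
    case (Suc n)
    let ?Z = "\<lambda>n \<omega>. indicator {\<omega> \<in> space M. \<forall>k<n. 0 < S k \<omega>} \<omega> :: ennreal"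
    have "(\<integral>\<^sup>+\<omega>. ?Z (Suc n) \<omega> * indicator {\<omega> \<in> space M. (\<lambda>_. True) (map (\<lambda>k. Y k \<omega>) [0..<Suc n])} \<omega> \<partial>M) =
      1 * (\<integral>\<^sup>+\<omega>. ?Z n \<omega> * indicator {\<omega> \<in> space M. (\<lambda>_. True) (map (\<lambda>k. Y k \<omega>) [0..<Suc n])} \<omega> \<partial>M)"
    proof (rule nn_integral_history_mult[where c = "\<lambda>_. 1"])
      fix x :: "nat \<Rightarrow> nat"
      let ?H = "{\<omega> \<in> space M. \<forall>k\<le>n. Y k \<omega> = x k}"
      have *: "(\<integral>\<^sup>+\<omega>. ?Z m \<omega> * indicator ?H \<omega> \<partial>M) =
          ennreal (prob {\<omega> \<in> space M. (\<forall>k\<le>n. Y k \<omega> = x k) \<and> (\<forall>k<m. 0 < S k \<omega>)})" for m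
      proof -
        have "{\<omega> \<in> space M. (\<forall>k\<le>n. Y k \<omega> = x k) \<and> (\<forall>k<m. 0 < S k \<omega>)} =
            {\<omega> \<in> space M. \<forall>k<m. 0 < S k \<omega>} \<inter> ?H"
          by auto
        then show ?thesis
          by (simp add: emeasure_eq_measure[symmetric] indicator_inter_arith[symmetric])
      qed
      show "(\<integral>\<^sup>+\<omega>. ?Z (Suc n) \<omega> * indicator ?H \<omega> \<partial>M) = 1 * (\<integral>\<^sup>+\<omega>. ?Z n \<omega> * indicator ?H \<omega> \<partial>M)"
        unfolding * using tail[of "\<lambda>_. 0" n x] by simp
    qed auto
    then have "emeasure M {\<omega> \<in> space M. \<forall>k<Suc n. 0 < S k \<omega>} = emeasure M {\<omega> \<in> space M. \<forall>k<n. 0 < S k \<omega>}"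
      by (simp add: indicator_inter_arith[symmetric] Int_absorb2 subset_eq)
    then show ?case using Suc by (simp add: measure_def)
  qed (simp add: prob_space)
  have pos: "AE \<omega> in M. \<forall>n. 0 < S n \<omega>"
    unfolding AE_all_countable
  proof
    fix n
    have "AE \<omega> in M. \<forall>k<Suc n. 0 < S k \<omega>"
      using pos_n[of "Suc n"] by (subst prob_Collect_eq_1[symmetric]) auto
    then show "AE \<omega> in M. 0 < S n \<omega>" by eventually_elim simp
  qed
  have drop_pos: "prob {\<omega> \<in> space M. Q \<omega> \<and> (\<forall>k<m. 0 < S k \<omega>)} = prob {\<omega> \<in> space M. Q \<omega>}"
    if [measurable]: "Measurable.pred M Q" for Q m
    by (rule finite_measure_eq_AE) (use pos in \<open>auto elim!: eventually_mono\<close>)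
  have "bd_chain lam mu (\<lambda>i. 1 / ?q i) M Y S \<nu>"
  proof
    show "prob {\<omega> \<in> space M. \<forall>k\<le>Suc n. Y k \<omega> = x k} =
      prob {\<omega> \<in> space M. \<forall>k\<le>n. Y k \<omega> = x k} * step (x n) (x (Suc n))" for n x
      using law[of "\<lambda>_. 0" n x] drop_pos[of "\<lambda>\<omega>. \<forall>k\<le>n. Y k \<omega> = x k" n]
        drop_pos[of "\<lambda>\<omega>. \<forall>k\<le>Suc n. Y k \<omega> = x k" "Suc n"] by simp
    fix n and x :: "nat \<Rightarrow> nat"
    let ?H = "{\<omega> \<in> space M. \<forall>k\<le>n. Y k \<omega> = x k}"
    have "(\<integral>\<^sup>+\<omega>. ennreal (S n \<omega>) * indicator ?H \<omega> \<partial>M) = ennreal (prob ?H / ?q (x n))"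
    proof (rule nn_integral_exponential_tail)
      fix s :: real assume s: "0 \<le> s"
      \<comment> \<open>A threshold at index \<open>n\<close> only; the earlier ones are 0 and drop
        out.\<close>
      let ?s = "\<lambda>k. if k = n then s else 0"
      have A: "prob {\<omega> \<in> ?H. s < S n \<omega>} =
          prob {\<omega> \<in> space M. ((\<forall>k\<le>n. Y k \<omega> = x k) \<and> s < S n \<omega>) \<and> (\<forall>k<n. 0 < S k \<omega>)}"
        by (subst drop_pos) (auto intro: arg_cong[where f = prob])
      have B: "{\<omega> \<in> space M. ((\<forall>k\<le>n. Y k \<omega> = x k) \<and> s < S n \<omega>) \<and> (\<forall>k<n. 0 < S k \<omega>)} =
          {\<omega> \<in> space M. (\<forall>k\<le>n. Y k \<omega> = x k) \<and> (\<forall>k<Suc n. ?s k < S k \<omega>)}"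
        by (auto simp: less_Suc_eq)
      have C: "(\<forall>k<n. ?s k < S k \<omega>) \<longleftrightarrow> (\<forall>k<n. 0 < S k \<omega>)" for \<omega>
        by auto
      have D: "prob {\<omega> \<in> space M. (\<forall>k\<le>n. Y k \<omega> = x k) \<and> (\<forall>k<n. 0 < S k \<omega>)} = prob ?H"
        by (rule drop_pos) measurable
      show "prob {\<omega> \<in> ?H. s < S n \<omega>} = prob ?H * exp (- ?q (x n) * s)"
        unfolding A B using tail[of ?s n x] s unfolding C D by simp
    qed (use q in \<open>auto simp: finite_measure_axioms\<close>)
    also have "\<dots> = ennreal (1 / ?q (x n)) * emeasure M ?H"
      using q[of "x n"] by (simp add: emeasure_eq_measure flip: ennreal_mult)
    finally show "(\<integral>\<^sup>+\<omega>. ennreal (S n \<omega>) * indicator ?H \<omega> \<partial>M) = ennreal (1 / ?q (x n)) * emeasure M ?H" .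
  qed (auto simp: init)
  moreover have "AE \<omega> in M. (\<forall>n. 0 < S n \<omega>) \<and>
      (\<forall>t\<ge>0. \<exists>n. (\<Sum>k<n. S k \<omega>) \<le> t \<and> t < (\<Sum>k<Suc n. S k \<omega>) \<and> X t \<omega> = Y n \<omega>)"
    using pos cover by eventually_elim simp
  moreover have first: "prob {\<omega> \<in> space M. Y 0 \<omega> = j \<and> s < S 0 \<omega>} = pmf \<nu> j * exp (- ?q j * s)"
    if "0 \<le> s" for s j
    using tail[of "\<lambda>_. s" 0 "\<lambda>_. j"] that by (simp add: init)
  moreover have "prob {\<omega> \<in> space M. Y 0 \<omega> = i \<and> Y 1 \<omega> = j \<and> s < S 0 \<omega> \<and> t < S 1 \<omega>} =
      pmf \<nu> i * exp (- ?q i * s) * (bd_rate lam mu i j / ?q i) * exp (- ?q j * t)"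
    if "0 \<le> s" "0 \<le> t" for s t i j
  proof -
    \<comment> \<open>The first holding time and the jump come from \<open>law\<close>, the second
      holding time from \<open>tail\<close>.\<close>
    let ?y = "\<lambda>k :: nat. if k = 0 then i else j"
    let ?s = "\<lambda>k :: nat. if k = 0 then s else t"
    have le1: "(\<forall>k\<le>Suc 0. Q k) \<longleftrightarrow> Q 0 \<and> Q 1" and less2: "(\<forall>k<Suc (Suc 0). Q k) \<longleftrightarrow> Q 0 \<and> Q 1" for Q
      by (auto simp: le_Suc_eq less_Suc_eq)
    show ?thesis
      using tail[of ?s "Suc 0" ?y] law[of ?s 0 ?y] that unfolding le1 less2
      by (simp add: init step conj_ac mult_ac)
  qed
  ultimately show ?thesis by blast
qed

section \<open>The stationary law in continuous time\<close>

lemma exp_difference_quotient: "((\<lambda>t. (1 - exp (- q * t)) / t) \<longlongrightarrow> (q :: real)) (at_right 0)"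
proof -
  have "((\<lambda>t. 1 - exp (- q * t)) has_real_derivative q) (at 0)"
    by (auto intro!: derivative_eq_intros)
  then have "((\<lambda>t. (1 - exp (- q * t)) / t) \<longlongrightarrow> q) (at 0)"
    by (simp add: DERIV_def)
  then show ?thesis by (rule filterlim_mono[OF _ order_refl at_le]) simp
qed

text \<open>Only paths with at most one jump before time \<open>t\<close> are counted, so the limit \<open>t \<longlonglongrightarrow> 0\<close> gives an
  inequality; this avoids any uniformity of the rates over infinitely many initial states.\<close>

lemma bd_continuous_superinvariant:
  fixes M :: "'w measure"
  assumes lam: "\<And>n. lam n > 0" and mu: "\<And>n. n \<ge> 1 \<Longrightarrow> mu n > 0"
    and cont: "bd_continuous lam mu \<pi> M X"
    and stat: "\<And>t j. 0 \<le> t \<Longrightarrow> measure M {\<omega> \<in> space M. X t \<omega> = j} = pmf \<pi> j"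
  shows "(if j = 0 then 0 else lam (j - 1) * pmf \<pi> (j - 1)) + mu (Suc j) * pmf \<pi> (Suc j)
      \<le> bd_exit_rate lam mu j * pmf \<pi> j"
proof -
  let ?q = "bd_exit_rate lam mu"
  have mu': "\<forall>n\<ge>1. mu n > 0" using mu by blast
  let ?r = "\<lambda>i. bd_rate lam mu i j / ?q i"
  obtain Y S where chain: "bd_chain lam mu (\<lambda>i. 1 / ?q i) M Y S \<pi>"
    and AE: "AE \<omega> in M. (\<forall>n. 0 < S n \<omega>) \<and>
      (\<forall>t\<ge>0. \<exists>n. (\<Sum>k<n. S k \<omega>) \<le> t \<and> t < (\<Sum>k<Suc n. S k \<omega>) \<and> X t \<omega> = Y n \<omega>)"
    and first: "\<forall>s\<ge>0. \<forall>j. measure M {\<omega> \<in> space M. Y 0 \<omega> = j \<and> s < S 0 \<omega>} =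
      pmf \<pi> j * exp (- ?q j * s)"
    and second: "\<forall>s\<ge>0. \<forall>t\<ge>0. \<forall>i j.
      measure M {\<omega> \<in> space M. Y 0 \<omega> = i \<and> Y 1 \<omega> = j \<and> s < S 0 \<omega> \<and> t < S 1 \<omega>} =
      pmf \<pi> i * exp (- ?q i * s) * (bd_rate lam mu i j / ?q i) * exp (- ?q j * t)"
    using bd_continuous_chain[OF lam mu' cont] by (elim exE conjE) (rule that)
  interpret bd_chain lam mu "\<lambda>i. 1 / ?q i" M Y S \<pi> by (rule chain)
  \<comment> \<open>The states from which a single jump leads to \<open>j\<close>.\<close>
  define I where "I = {i. i = Suc j \<or> j = Suc i}"
  have I: "I = (if j = 0 then {Suc j} else {j - 1, Suc j})"
    unfolding I_def by (cases j) auto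
  have le: "(\<Sum>i\<in>I. pmf \<pi> i * ?r i * ((1 - exp (- ?q i * t)) / t)) * exp (- ?q j * t) \<le>
      pmf \<pi> j * ((1 - exp (- ?q j * t)) / t)" if t: "0 < t" for t
  proof -
    let ?E = "{\<omega> \<in> space M. Y 0 \<omega> = j \<and> t < S 0 \<omega>}"
    \<comment> \<open>Start in \<open>i\<close>, jump to \<open>j\<close> by time \<open>t\<close>,
      then hold for longer than \<open>t\<close>, so that \<open>j\<close> is occupied at time
      \<open>t\<close>. The event is a difference because the law gives only lower bounds on holding
      times.\<close>
    let ?F = "\<lambda>i. {\<omega> \<in> space M. Y 0 \<omega> = i \<and> Y 1 \<omega> = j \<and> 0 < S 0 \<omega> \<and> t < S 1 \<omega>}
      - {\<omega> \<in> space M. Y 0 \<omega> = i \<and> Y 1 \<omega> = j \<and> t < S 0 \<omega> \<and> t < S 1 \<omega>}"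
    have F: "prob (?F i) = pmf \<pi> i * ?r i * (1 - exp (- ?q i * t)) * exp (- ?q j * t)" for i
    proof -
      have "prob (?F i) = prob {\<omega> \<in> space M. Y 0 \<omega> = i \<and> Y 1 \<omega> = j \<and> 0 < S 0 \<omega> \<and> t < S 1 \<omega>}
          - prob {\<omega> \<in> space M. Y 0 \<omega> = i \<and> Y 1 \<omega> = j \<and> t < S 0 \<omega> \<and> t < S 1 \<omega>}"
        by (rule finite_measure_Diff) (use t in auto)
      also have "\<dots> = pmf \<pi> i * ?r i * (1 - exp (- ?q i * t)) * exp (- ?q j * t)"
        unfolding second[rule_format, OF order_refl less_imp_le[OF t]]
          second[rule_format, OF less_imp_le[OF t] less_imp_le[OF t]]
        by (simp add: algebra_simps diff_divide_distrib)
      finally show ?thesis .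
    qed
    have "pmf \<pi> j * exp (- ?q j * t) + (\<Sum>i\<in>I. prob (?F i)) = prob ?E + prob (\<Union>i\<in>I. ?F i)"
    proof -
      have "prob (\<Union>i\<in>I. ?F i) = (\<Sum>i\<in>I. prob (?F i))"
        by (rule finite_measure_finite_Union) (auto simp: disjoint_family_on_def I)
      then show ?thesis using t by (simp add: first)
    qed
    also have "\<dots> = prob (?E \<union> (\<Union>i\<in>I. ?F i))"
      by (rule finite_measure_Union[symmetric]) (auto simp: I)
    also have "\<dots> \<le> prob {\<omega> \<in> space M. X t \<omega> = j}"
    proof (rule finite_measure_mono_AE)
      show "AE \<omega> in M. \<omega> \<in> ?E \<union> (\<Union>i\<in>I. ?F i) \<longrightarrow> \<omega> \<in> {\<omega> \<in> space M. X t \<omega> = j}"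
        using AE
      proof eventually_elim
        case (elim \<omega>)
        then obtain n where n: "(\<Sum>k<n. S k \<omega>) \<le> t" "t < (\<Sum>k<Suc n. S k \<omega>)" "X t \<omega> = Y n \<omega>"
          using t less_imp_le by blast
        have idx: "n = m" if "(\<Sum>k<m. S k \<omega>) \<le> t" "t < (\<Sum>k<Suc m. S k \<omega>)" for m
          by (rule jump_index_unique[OF _ n(1,2) that]) (use elim in auto)
        show ?case
        proof
          assume "\<omega> \<in> ?E \<union> (\<Union>i\<in>I. ?F i)"
          then consider "\<omega> \<in> space M" "Y 0 \<omega> = j" "t < S 0 \<omega>"
            | "\<omega> \<in> space M" "Y 1 \<omega> = j" "S 0 \<omega> \<le> t" "t < S 1 \<omega>" "0 < S 0 \<omega>"
            by auto
          then show "\<omega> \<in> {\<omega> \<in> space M. X t \<omega> = j}"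
          proof cases
            case 1
            then show ?thesis using idx[of 0] t n(3) by simp
          next
            case 2
            then show ?thesis using idx[of 1] t n(3) by simp
          qed
        qed
      qed
      have "X t \<in> measurable M (count_space UNIV)"
        using cont t by (simp add: bd_continuous_def)
      then show "{\<omega> \<in> space M. X t \<omega> = j} \<in> sets M" by measurable
    qed
    also have "\<dots> = pmf \<pi> j" using stat[of t j] t by simp
    finally have "(\<Sum>i\<in>I. pmf \<pi> i * ?r i * (1 - exp (- ?q i * t))) * exp (- ?q j * t) \<le>
        pmf \<pi> j * (1 - exp (- ?q j * t))"
      unfolding F sum_distrib_right[symmetric] right_diff_distrib[of "pmf \<pi> j"] by linarith
    from divide_right_mono[OF this less_imp_le[OF t]] show ?thesis
      by (simp only: times_divide_eq_right times_divide_eq_left sum_divide_distrib[symmetric])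
  qed
  have "(\<Sum>i\<in>I. pmf \<pi> i * ?r i * ?q i) * exp (- ?q j * 0) \<le> pmf \<pi> j * ?q j"
  proof (rule tendsto_le[OF trivial_limit_at_right_real])
    show "((\<lambda>t. pmf \<pi> j * ((1 - exp (- ?q j * t)) / t)) \<longlongrightarrow> pmf \<pi> j * ?q j) (at_right 0)"
      by (intro tendsto_mult tendsto_const exp_difference_quotient)
    show "((\<lambda>t. (\<Sum>i\<in>I. pmf \<pi> i * ?r i * ((1 - exp (- ?q i * t)) / t)) * exp (- ?q j * t)) \<longlongrightarrow>
      (\<Sum>i\<in>I. pmf \<pi> i * ?r i * ?q i) * exp (- ?q j * 0)) (at_right 0)"
      by (intro tendsto_mult tendsto_sum tendsto_const exp_difference_quotient tendsto_exp tendsto_ident_at)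
    show "\<forall>\<^sub>F t in at_right 0. (\<Sum>i\<in>I. pmf \<pi> i * ?r i * ((1 - exp (- ?q i * t)) / t)) * exp (- ?q j * t) \<le>
      pmf \<pi> j * ((1 - exp (- ?q j * t)) / t)"
      using le by (intro eventually_at_rightI[of 0 1]) auto
  qed
  moreover have "(\<Sum>i\<in>I. pmf \<pi> i * ?r i * ?q i) = (\<Sum>i\<in>I. pmf \<pi> i * bd_rate lam mu i j)"
    using exit_rate_pos by (intro sum.cong) (auto simp: less_imp_neq[THEN not_sym])
  moreover have "\<dots> = (if j = 0 then 0 else lam (j - 1) * pmf \<pi> (j - 1)) + mu (Suc j) * pmf \<pi> (Suc j)"
    by (cases j) (auto simp: I bd_rate_def mult.commute)
  ultimately show ?thesis by (simp add: mult.commute)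
qed

section \<open>The formulas in each time model\<close>

lemma mean_hitting_formulas_Discrete:
  fixes P :: "nat pmf \<Rightarrow> 'w measure" and \<pi> :: "nat pmf"
  assumes lam: "\<And>n. lam n > 0" and mu: "\<And>n. n \<ge> 1 \<Longrightarrow> mu n > 0"
    and bd: "birth_death_process Discrete lam mu P X" and rec: "positive_recurrent Discrete P X"
    and stat: "stationary_distribution Discrete P X \<pi>"
  shows "(K_prime Discrete P X \<pi> < \<infinity> \<longleftrightarrow> Theta lam \<pi> < \<infinity>) \<and>
    (Theta lam \<pi> < \<infinity> \<longrightarrow>
       K_prime Discrete P X \<pi> = Theta lam \<pi> - mean_hitting_time Discrete P X \<pi> 0 \<and>
       mean_hitting_time Discrete P X \<pi> 0 =
         (\<Sum>k. ennreal (inverse (lam k * pmf \<pi> k) * (\<Sum>\<^sub>\<infinity>j\<in>{k+1..}. pmf \<pi> j)\<^sup>2)) \<and>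
       mean_hitting_time Discrete P X \<pi> 0 < Theta lam \<pi>)"
proof -
  have chain: "bd_chain lam mu (\<lambda>_. 1) (P \<nu>) (\<lambda>n. X (real n)) (\<lambda>_ _. 1) \<nu>" for \<nu>
    using bd by (intro bd_discrete_chain lam mu) (simp_all add: birth_death_process_def)
  interpret bd_rates lam mu "\<lambda>_. 1" using chain by (rule bd_chain.axioms(1))
  show ?thesis
  proof (rule mean_hitting_formulas)
    fix \<nu> j
    interpret C: bd_chain lam mu "\<lambda>_. 1" "P \<nu>" "\<lambda>n. X (real n)" "\<lambda>_ _. 1" \<nu> by (rule chain)
    have "mean_hitting_time Discrete P X \<nu> j =
      (\<integral>\<^sup>+\<omega>. (\<Sum>n. ennreal 1 * indicator {\<omega> \<in> space (P \<nu>). \<forall>k\<le>n. X (real k) \<omega> \<noteq> j} \<omega>) \<partial>P \<nu>)"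
      unfolding mean_hitting_time_def hitting_time_Discrete
      by (intro nn_integral_cong suminf_cong) (auto simp: indicator_def)
    also have "\<dots> = (\<Sum>n. \<integral>\<^sup>+\<omega>. ennreal 1 * indicator {\<omega> \<in> space (P \<nu>). \<forall>k\<le>n. X (real k) \<omega> \<noteq> j} \<omega> \<partial>P \<nu>)"
      using C.Y_measurable by (intro nn_integral_suminf) measurable
    finally show "\<exists>Y S. bd_chain lam mu (\<lambda>_. 1) (P \<nu>) Y S \<nu> \<and> mean_hitting_time Discrete P X \<nu> j =
      (\<Sum>n. \<integral>\<^sup>+\<omega>. ennreal (S n \<omega>) * indicator {\<omega> \<in> space (P \<nu>). \<forall>k\<le>n. Y k \<omega> \<noteq> j} \<omega> \<partial>P \<nu>)"
      using chain by blast
  next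
    interpret C: bd_chain lam mu "\<lambda>_. 1" "P (return_pmf 0)" "\<lambda>n. X (real n)" "\<lambda>_ _. 1" "return_pmf 0"
      by (rule chain)
    have "measure (P (return_pmf 0)) {\<omega> \<in> space (P (return_pmf 0)). \<forall>k\<ge>1. X (real k) \<omega> \<noteq> 0} = 0"
    proof (rule null_set_of_infinite[OF C.finite_measure_axioms])
      show "AE \<omega> in P (return_pmf 0). (\<forall>k\<ge>1. X (real k) \<omega> \<noteq> 0) \<longrightarrow> return_time Discrete X 0 \<omega> = \<infinity>"
      proof (rule AE_I2, rule impI)
        fix \<omega> assume "\<forall>k\<ge>1. X (real k) \<omega> \<noteq> 0"
        then have "{t \<in> \<nat>. 1 \<le> t \<and> X t \<omega> = 0} = {}" by (auto simp: Nats_def)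
        then show "return_time Discrete X 0 \<omega> = \<infinity>" by (simp only: return_time.simps) simp
      qed
      show "(\<integral>\<^sup>+\<omega>. return_time Discrete X 0 \<omega> \<partial>P (return_pmf 0)) < \<infinity>"
        using rec by (simp add: positive_recurrent_def)
    qed (use C.Y_measurable in measurable)
    then show "\<exists>Y S. bd_chain lam mu (\<lambda>_. 1) (P (return_pmf 0)) Y S (return_pmf 0) \<and>
      measure (P (return_pmf 0)) {\<omega> \<in> space (P (return_pmf 0)). \<forall>k\<ge>1. Y k \<omega> \<noteq> 0} = 0"
      using chain by blast
  next
    fix i
    interpret C: bd_chain lam mu "\<lambda>_. 1" "P \<pi>" "\<lambda>n. X (real n)" "\<lambda>_ _. 1" \<pi> by (rule chain)
    \<comment> \<open>Stationarity at time 1 gives the balance equation with equality.\<close>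
    have "measure (P \<pi>) {\<omega> \<in> space (P \<pi>). X (real 1) \<omega> = i} = pmf \<pi> i"
      using stat unfolding stationary_distribution_def by simp
    then show "(if i = 0 then 0 else lam (i - 1) * pmf \<pi> (i - 1)) + mu (Suc i) * pmf \<pi> (Suc i)
      \<le> bd_exit_rate lam mu i * pmf \<pi> i"
      using C.one_step[of i] by (simp add: algebra_simps)
  qed
qed

lemma mean_hitting_formulas_Continuous:
  fixes P :: "nat pmf \<Rightarrow> 'w measure" and \<pi> :: "nat pmf"
  assumes lam: "\<And>n. lam n > 0" and mu: "\<And>n. n \<ge> 1 \<Longrightarrow> mu n > 0"
    and bd: "birth_death_process Continuous lam mu P X" and rec: "positive_recurrent Continuous P X"
    and stat: "stationary_distribution Continuous P X \<pi>"
  shows "(K_prime Continuous P X \<pi> < \<infinity> \<longleftrightarrow> Theta lam \<pi> < \<infinity>) \<and>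
    (Theta lam \<pi> < \<infinity> \<longrightarrow>
       K_prime Continuous P X \<pi> = Theta lam \<pi> - mean_hitting_time Continuous P X \<pi> 0 \<and>
       mean_hitting_time Continuous P X \<pi> 0 =
         (\<Sum>k. ennreal (inverse (lam k * pmf \<pi> k) * (\<Sum>\<^sub>\<infinity>j\<in>{k+1..}. pmf \<pi> j)\<^sup>2)) \<and>
       mean_hitting_time Continuous P X \<pi> 0 < Theta lam \<pi>)"
proof -
  let ?w = "\<lambda>i. 1 / bd_exit_rate lam mu i"
  have cont: "bd_continuous lam mu \<nu> (P \<nu>) X" for \<nu>
    using bd by (simp add: birth_death_process_def)
  have mu': "\<forall>n\<ge>1. mu n > 0" using mu by blast
  have ex: "\<exists>Y S. bd_chain lam mu ?w (P \<nu>) Y S \<nu> \<and> (AE \<omega> in P \<nu>. (\<forall>n. 0 < S n \<omega>) \<and>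
      (\<forall>t\<ge>0. \<exists>n. (\<Sum>k<n. S k \<omega>) \<le> t \<and> t < (\<Sum>k<Suc n. S k \<omega>) \<and> X t \<omega> = Y n \<omega>))" for \<nu>
    using bd_continuous_chain[OF lam mu' cont[of \<nu>]] by blast
  interpret bd_rates lam mu ?w using ex bd_chain.axioms(1) by blast
  show ?thesis
  proof (rule mean_hitting_formulas)
    fix \<nu> j
    obtain Y S where chain: "bd_chain lam mu ?w (P \<nu>) Y S \<nu>"
      and AE: "AE \<omega> in P \<nu>. (\<forall>n. 0 < S n \<omega>) \<and>
      (\<forall>t\<ge>0. \<exists>n. (\<Sum>k<n. S k \<omega>) \<le> t \<and> t < (\<Sum>k<Suc n. S k \<omega>) \<and> X t \<omega> = Y n \<omega>)"
      using ex[of \<nu>] by blast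
    interpret C: bd_chain lam mu ?w "P \<nu>" Y S \<nu> by (rule chain)
    have "mean_hitting_time Continuous P X \<nu> j =
      (\<integral>\<^sup>+\<omega>. (\<Sum>n. ennreal (S n \<omega>) * indicator {\<omega> \<in> space (P \<nu>). \<forall>k\<le>n. Y k \<omega> \<noteq> j} \<omega>) \<partial>P \<nu>)"
      unfolding mean_hitting_time_def
    proof (rule nn_integral_cong_AE)
      show "AE \<omega> in P \<nu>. hitting_time Continuous X j \<omega> =
        (\<Sum>n. ennreal (S n \<omega>) * indicator {\<omega> \<in> space (P \<nu>). \<forall>k\<le>n. Y k \<omega> \<noteq> j} \<omega>)"
        using AE AE_space
      proof eventually_elim
        case (elim \<omega>)
        have "hitting_time Continuous X j \<omega> =
          (\<Sum>n. ennreal (S n \<omega>) * (if \<forall>k\<le>n. Y k \<omega> \<noteq> j then 1 else 0))"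
        proof (rule hitting_time_jump)
          show "\<exists>n. (\<Sum>k<n. S k \<omega>) \<le> t \<and> t < (\<Sum>k<Suc n. S k \<omega>) \<and> X t \<omega> = Y n \<omega>"
            if "t \<in> time_set Continuous" for t
            using elim(1) that by auto
          show "(\<Sum>k<n. S k \<omega>) \<in> time_set Continuous" for n
            using elim(1) by (simp add: sum_nonneg less_imp_le)
        qed (use elim in auto)
        also have "\<dots> = (\<Sum>n. ennreal (S n \<omega>) * indicator {\<omega> \<in> space (P \<nu>). \<forall>k\<le>n. Y k \<omega> \<noteq> j} \<omega>)"
          using elim(2) by (intro suminf_cong) (auto simp: indicator_def)
        finally show ?case .
      qed
    qed
    also have "\<dots> = (\<Sum>n. \<integral>\<^sup>+\<omega>. ennreal (S n \<omega>) * indicator {\<omega> \<in> space (P \<nu>). \<forall>k\<le>n. Y k \<omega> \<noteq> j} \<omega> \<partial>P \<nu>)"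
      by (rule nn_integral_suminf) measurable
    finally show "\<exists>Y S. bd_chain lam mu ?w (P \<nu>) Y S \<nu> \<and> mean_hitting_time Continuous P X \<nu> j =
      (\<Sum>n. \<integral>\<^sup>+\<omega>. ennreal (S n \<omega>) * indicator {\<omega> \<in> space (P \<nu>). \<forall>k\<le>n. Y k \<omega> \<noteq> j} \<omega> \<partial>P \<nu>)"
      using chain by blast
  next
    let ?M = "P (return_pmf 0)"
    obtain Y S where chain: "bd_chain lam mu ?w ?M Y S (return_pmf 0)"
      and AE: "AE \<omega> in ?M. (\<forall>n. 0 < S n \<omega>) \<and>
      (\<forall>t\<ge>0. \<exists>n. (\<Sum>k<n. S k \<omega>) \<le> t \<and> t < (\<Sum>k<Suc n. S k \<omega>) \<and> X t \<omega> = Y n \<omega>)"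
      using ex[of "return_pmf 0"] by blast
    interpret C: bd_chain lam mu ?w ?M Y S "return_pmf 0" by (rule chain)
    have "measure ?M {\<omega> \<in> space ?M. \<forall>k\<ge>1. Y k \<omega> \<noteq> 0} = 0"
    proof (rule null_set_of_infinite[OF C.finite_measure_axioms])
      show "AE \<omega> in ?M. (\<forall>k\<ge>1. Y k \<omega> \<noteq> 0) \<longrightarrow> return_time Continuous X 0 \<omega> = \<infinity>"
        using AE
      proof eventually_elim
        case (elim \<omega>)
        have S: "0 < S n \<omega>" for n using elim by blast
        have cover: "\<exists>n. (\<Sum>k<n. S k \<omega>) \<le> t \<and> t < (\<Sum>k<Suc n. S k \<omega>) \<and> X t \<omega> = Y n \<omega>" if "0 \<le> t" for t
          using elim that by blast
        have init: "X t \<omega> = Y 0 \<omega>" if t: "0 \<le> t" "t < S 0 \<omega>" for t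
        proof -
          obtain n where n: "(\<Sum>k<n. S k \<omega>) \<le> t" "t < (\<Sum>k<Suc n. S k \<omega>)" "X t \<omega> = Y n \<omega>"
            using cover[OF t(1)] by blast
          have "n = 0" by (rule jump_index_unique[OF S n(1,2)]) (use t in auto)
          then show ?thesis using n by simp
        qed
        show ?case
        proof
          assume never: "\<forall>k\<ge>1. Y k \<omega> \<noteq> 0"
          have "{t. X t \<omega> = 0 \<and> (\<exists>s. 0 \<le> s \<and> s < t \<and> X s \<omega> \<noteq> X 0 \<omega>)} = {}"
          proof -
            \<comment> \<open>A time after \<open>X\<close> has left its initial state lies beyond
              the first jump, so its index is at least 1 and \<open>Y\<close> would visit 0 after
              step 0.\<close>
            have False if t: "X t \<omega> = 0" "0 \<le> s" "s < t" "X s \<omega> \<noteq> X 0 \<omega>" for t s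
            proof -
              have "S 0 \<omega> \<le> s" using t init[of s] init[of 0] S[of 0] by (metis not_le order_refl)
              obtain n where n: "(\<Sum>k<n. S k \<omega>) \<le> t" "t < (\<Sum>k<Suc n. S k \<omega>)" "X t \<omega> = Y n \<omega>"
                using cover[of t] t by auto
              with \<open>S 0 \<omega> \<le> s\<close> t(3) have "n \<ge> 1" by (cases n) auto
              then show False using never n(3) t(1) by metis
            qed
            then show ?thesis by blast
          qed
          then show "return_time Continuous X 0 \<omega> = \<infinity>" by (simp only: return_time.simps) simp
        qed
      qed
      show "(\<integral>\<^sup>+\<omega>. return_time Continuous X 0 \<omega> \<partial>?M) < \<infinity>"
        using rec by (simp add: positive_recurrent_def)
    qed measurable
    then show "\<exists>Y S. bd_chain lam mu ?w ?M Y S (return_pmf 0) \<and>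
      measure ?M {\<omega> \<in> space ?M. \<forall>k\<ge>1. Y k \<omega> \<noteq> 0} = 0"
      using chain by blast
  next
    fix i
    show "(if i = 0 then 0 else lam (i - 1) * pmf \<pi> (i - 1)) + mu (Suc i) * pmf \<pi> (Suc i)
      \<le> bd_exit_rate lam mu i * pmf \<pi> i"
      by (rule bd_continuous_superinvariant[OF lam mu cont])
        (use stat in \<open>auto simp: stationary_distribution_def\<close>)
  qed
qed

theorem theorem5p1:
  fixes T :: time_model
    and lam mu :: "nat \<Rightarrow> real"
    and P :: "nat pmf \<Rightarrow> 'w measure"
    and X :: "real \<Rightarrow> 'w \<Rightarrow> nat"
    and \<pi> :: "nat pmf"
  assumes "\<And>n. lam n > 0"
    and "\<And>n. n \<ge> 1 \<Longrightarrow> mu n > 0"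
    and "birth_death_process T lam mu P X"
    and "irreducible_process T P X"
    and "positive_recurrent T P X"
    and "stationary_distribution T P X \<pi>"
  shows "(K_prime T P X \<pi> < \<infinity> \<longleftrightarrow> Theta lam \<pi> < \<infinity>) \<and>
    (Theta lam \<pi> < \<infinity> \<longrightarrow>
       K_prime T P X \<pi> = Theta lam \<pi> - mean_hitting_time T P X \<pi> 0 \<and>
       mean_hitting_time T P X \<pi> 0 =
         (\<Sum>k. ennreal (inverse (lam k * pmf \<pi> k) * (\<Sum>\<^sub>\<infinity>j\<in>{k+1..}. pmf \<pi> j)\<^sup>2)) \<and>
       mean_hitting_time T P X \<pi> 0 < Theta lam \<pi>)"
proof (cases T)
  case Discrete
  show ?thesis
    using mean_hitting_formulas_Discrete assms unfolding Discrete by blast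
next
  case Continuous
  show ?thesis
    using mean_hitting_formulas_Continuous assms unfolding Continuous by blast
qed

end
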